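(* Let $\mathbb{F}$ be a field. Up to isomorphism there is a unique nilpotent symplectic alternating algebra $L$ over $\mathbb{F}$ of dimension $10$ with an isotropic center $Z(L)$ of dimension $2$ that has the further properties that $L$ is nilpotent of class $6$ and $L^{3}L^{3}\leq Z(L)$. This algebra can be given by the presentation $$\mathcal{P}_{10}^{(2,1)}:\ (x_{3}y_{4},y_{5})=1,\ (x_{2}y_{3},y_{5})=1,\ (x_{1}y_{3},y_{4})=1,\ (y_{1}y_{2},y_{5})=1.$$
   Context: A symplectic alternating algebra (SAA) over a field $\mathbb{F}$ is a finite-dimensional $\mathbb{F}$-vector space $L$ with a non-degenerate alternating bilinear form $(\cdot,\cdot)$ and a bilinear alternating product $L\times L\to L$, $(x,y)\mapsto xy$ (so $xx=0$), such that $(xy,z)=(yz,x)$ for all $x,y,z\in L$. Consequently $(u,v,w)\mapsto (uv,w)$ is an alternating trilinear form, and by non-degeneracy it determines the product. An isomorphism of SAAs is a linear bijection preserving both the product and the form. For subspaces $U,V\le L$, $UV$ denotes the linear span of all products $uv$ with $u\in U$, $v\in V$. Put $L^{1}=L$, $L^{k+1}=L^{k}L$; $L$ is nilpotent if $L^{k+1}=0$ for some $k$, and the smallest such $k$ is its (nilpotence) class. The center is $Z(L)=\{z\in L: zx=0 \text{ for all } x\in L\}$. A subspace $U$ is isotropic if $(u,v)=0$ for all $u,v\in U$. A standard basis of a $10$-dimensional $L$ is a basis $x_{1},y_{1},\ldots,x_{5},y_{5}$ with $(x_i,x_j)=(y_i,y_j)=0$ and $(x_i,y_j)=\delta_{ij}$.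 A nilpotent presentation lists values of the triples $(x_iy_j,y_k)$ and $(y_iy_j,y_k)$ with $1\le i<j<k\le 5$ with respect to a standard basis. By convention, all triple values $(uv,w)$ of basis vectors $u,v,w$ which do not follow from the listed ones by the alternating property are $0$. Such a presentation determines an SAA up to isomorphism. *)

theory Defs
  imports "HOL-Analysis.Analysis" "HOL-Library.Multiset"
begin

locale symplectic_alternating_algebra = vector_space scale
  for scale :: "'f::field \<Rightarrow> 'v::ab_group_add \<Rightarrow> 'v" +
  fixes mul :: "'v \<Rightarrow> 'v \<Rightarrow> 'v" (infixl "\<cdot>" 70)
    and form :: "'v \<Rightarrow> 'v \<Rightarrow> 'f"
  assumes finite_dim: "\<exists>B. finite B \<and> span B = UNIV"
    and form_linear_left: "Vector_Spaces.linear scale (*) (\<lambda>u. form u v)"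
    and form_linear_right: "Vector_Spaces.linear scale (*) (\<lambda>v. form u v)"
    and form_alternating: "form u u = 0"
    and form_nondegenerate: "(\<And>v. form u v = 0) \<Longrightarrow> u = 0"
    and mul_linear_left: "Vector_Spaces.linear scale scale (\<lambda>u. u \<cdot> v)"
    and mul_linear_right: "Vector_Spaces.linear scale scale (\<lambda>v. u \<cdot> v)"
    and mul_alternating: "u \<cdot> u = 0"
    and form_mul_cyclic: "form (u \<cdot> v) w = form (v \<cdot> w) u"
begin

definition subspace_prod :: "'v set \<Rightarrow> 'v set \<Rightarrow> 'v set" where
  "subspace_prod U V = span {u \<cdot> v | u v. u \<in> U \<and> v \<in> V}"

text \<open>\<open>lower_central k\<close> is the ideal \<open>L\<^sup>k\<close> for \<open>k \<ge> 1\<close>; the value at 0 has no meaning.\<close>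

fun lower_central :: "nat \<Rightarrow> 'v set" where
  "lower_central 0 = UNIV"
| "lower_central (Suc 0) = UNIV"
| "lower_central (Suc (Suc k)) = subspace_prod (lower_central (Suc k)) UNIV"

definition nilpotent :: bool where
  "nilpotent \<longleftrightarrow> (\<exists>k. lower_central (k + 1) = {0})"

text \<open>Only meaningful for nilpotent algebras.\<close>

definition nilpotency_class :: nat where
  "nilpotency_class = (LEAST k. lower_central (k + 1) = {0})"

definition center :: "'v set" where
  "center = {z. \<forall>x. z \<cdot> x = 0}"

definition isotropic :: "'v set \<Rightarrow> bool" where
  "isotropic U \<longleftrightarrow> (\<forall>u\<in>U. \<forall>v\<in>U. form u v = 0)"

end

definition saa_isomorphic ::
  "('f::field \<Rightarrow> 'v::ab_group_add \<Rightarrow> 'v) \<Rightarrow> ('v \<Rightarrow> 'v \<Rightarrow> 'v) \<Rightarrow> ('v \<Rightarrow> 'v \<Rightarrow> 'f) \<Rightarrow>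
   ('f \<Rightarrow> 'w::ab_group_add \<Rightarrow> 'w) \<Rightarrow> ('w \<Rightarrow> 'w \<Rightarrow> 'w) \<Rightarrow> ('w \<Rightarrow> 'w \<Rightarrow> 'f) \<Rightarrow> bool" where
  "saa_isomorphic scale1 mul1 form1 scale2 mul2 form2 \<longleftrightarrow>
     (\<exists>\<phi>. Vector_Spaces.linear scale1 scale2 \<phi> \<and> bij \<phi> \<and>
          (\<forall>u v. \<phi> (mul1 u v) = mul2 (\<phi> u) (\<phi> v)) \<and>
          (\<forall>u v. form2 (\<phi> u) (\<phi> v) = form1 u v))"

text \<open>
  \<open>X i\<close> and \<open>Y i\<close> are formal names for the elements \<open>x\<^sub>i\<close>, \<open>y\<^sub>i\<close> of a standard basis. A presentation
  is a set of entries \<open>(a, b, c, r)\<close>, each standing for the relation \<open>(ab, c) = r\<close>.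
\<close>

datatype label = X nat | Y nat

fun basis_elem :: "(nat \<Rightarrow> 'v) \<Rightarrow> (nat \<Rightarrow> 'v) \<Rightarrow> label \<Rightarrow> 'v" where
  "basis_elem x y (X i) = x i"
| "basis_elem x y (Y i) = y i"

definition labels :: "nat \<Rightarrow> label set" where
  "labels n = X ` {1..n} \<union> Y ` {1..n}"

context symplectic_alternating_algebra
begin

definition standard_basis :: "nat \<Rightarrow> (nat \<Rightarrow> 'v) \<Rightarrow> (nat \<Rightarrow> 'v) \<Rightarrow> bool" where
  "standard_basis n x y \<longleftrightarrow>
     inj_on (basis_elem x y) (labels n) \<and>
     independent (basis_elem x y ` labels n) \<and>
     span (basis_elem x y ` labels n) = UNIV \<and>
     (\<forall>i\<in>{1..n}. \<forall>j\<in>{1..n}.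
        form (x i) (x j) = 0 \<and> form (y i) (y j) = 0 \<and>
        form (x i) (y j) = (if i = j then 1 else 0))"

text \<open>
  The last conjunct is the convention on unlisted triples: a triple value \<open>(ab, c)\<close> follows from the
  listed ones by the alternating property if \<open>(a, b, c)\<close> is a rearrangement of a listed triple, or
  has a repeated entry (and then it is 0 anyway).
\<close>

definition has_presentation ::
  "nat \<Rightarrow> (nat \<Rightarrow> 'v) \<Rightarrow> (nat \<Rightarrow> 'v) \<Rightarrow> (label \<times> label \<times> label \<times> 'f) set \<Rightarrow> bool" where
  "has_presentation n x y P \<longleftrightarrow>
     standard_basis n x y \<and>
     (\<forall>(a, b, c, r)\<in>P. form (basis_elem x y a \<cdot> basis_elem x y b) (basis_elem x y c) = r) \<and>
     (\<forall>a\<in>labels n. \<forall>b\<in>labels n. \<forall>c\<in>labels n.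
        (\<forall>(a', b', c', r)\<in>P. {#a, b, c#} \<noteq> {#a', b', c'#}) \<longrightarrow>
        form (basis_elem x y a \<cdot> basis_elem x y b) (basis_elem x y c) = 0)"

end

definition P10_2_1 :: "(label \<times> label \<times> label \<times> 'f::field) set" where
  "P10_2_1 = {(X 3, Y 4, Y 5, 1), (X 2, Y 3, Y 5, 1), (X 1, Y 3, Y 4, 1), (Y 1, Y 2, Y 5, 1)}"

locale saa_P10_2_1 = symplectic_alternating_algebra scale mul form
  for scale :: "'f::field \<Rightarrow> 'v::ab_group_add \<Rightarrow> 'v" and mul form +
  assumes presented: "\<exists>x y. has_presentation 5 x y P10_2_1"

locale saa_dim10_class6 = symplectic_alternating_algebra scale mul form
  for scale :: "'f::field \<Rightarrow> 'v::ab_group_add \<Rightarrow> 'v" and mul form +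
  assumes dim_10: "dim (UNIV :: 'v set) = 10"
    and center_isotropic: "isotropic center"
    and dim_center: "dim center = 2"
    and nilpotent: "nilpotent"
    and class_6: "nilpotency_class = 6"
    and L3L3_le_center: "subspace_prod (lower_central 3) (lower_central 3) \<subseteq> center"

end

theory Submission
  imports Defs
begin

text \<open>
  Uniqueness comes from finding generators \<open>a\<close>, \<open>b\<close> adapted to the lower central series. Since
  \<open>L\<^sup>7 = 0\<close>, the ideal \<open>L\<^sup>i\<close> is orthogonal to \<open>L\<^sup>j\<close> whenever \<open>i + j \<ge> 8\<close>; in particular \<open>L\<^sup>4\<close>
  is isotropic and \<open>L\<^sup>3 L\<^sup>4 = 0\<close>. As the center, which is the orthogonal complement of \<open>L\<^sup>2\<close>, is
  a plane, \<open>L\<close> is spanned by two elements \<open>a\<close>, \<open>b\<close> modulo \<open>L\<^sup>2\<close>, \<open>L\<^sup>2\<close> by \<open>v = ab\<close> modulo \<open>L\<^sup>3\<close>,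
  and \<open>L\<^sup>3\<close> by \<open>va\<close>, \<open>vb\<close> modulo \<open>L\<^sup>4\<close>. The central element \<open>z = (va)(vb)\<close> is nonzero, for otherwise
  \<open>L\<^sup>6 = 0\<close>. A unimodular change of \<open>a\<close>, \<open>b\<close> gives \<open>(z, a) = 0\<close> and \<open>(z, b) = 1\<close>, and adding a multiple
  of \<open>v\<close> to \<open>a\<close> gives \<open>(va, vb) = 0\<close>. Then \<open>va, vb, -v, a, b\<close> are, up to a central correction of \<open>a\<close>,
  the \<open>y\<^sub>i\<close> of a standard basis, the \<open>x\<^sub>i\<close> being products of these elements lying in \<open>L\<^sup>4\<close>, and all
  triple values are forced.

  In coordinates, the presentation says that \<open>(uv, w)\<close> is a sum of four \<open>3 \<times> 3\<close> minors, from which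
  the remaining claims are read off.
\<close>

section \<open>The trilinear form in coordinates\<close>

text \<open>The determinant of the rows \<open>f\<close>, \<open>g\<close>, \<open>h\<close>
  restricted to the columns \<open>p\<close>, \<open>q\<close>, \<open>r\<close>, expanded along the
  first row.\<close>

definition minor :: "'l \<Rightarrow> 'l \<Rightarrow> 'l \<Rightarrow> ('l \<Rightarrow> 'f::field) \<Rightarrow> ('l \<Rightarrow> 'f) \<Rightarrow> ('l \<Rightarrow> 'f) \<Rightarrow> 'f" where
  "minor p q r f g h =
     f p * (g q * h r - g r * h q) - f q * (g p * h r - g r * h p) + f r * (g p * h q - g q * h p)"

text \<open>One minor for each entry of \<open>P10_2_1\<close>; the sum is the alternating trilinear
  form that the presentation prescribes, acting on coordinate functions.\<close>

definition vol :: "(label \<Rightarrow> 'f::field) \<Rightarrow> (label \<Rightarrow> 'f) \<Rightarrow> (label \<Rightarrow> 'f) \<Rightarrow> 'f" where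
  "vol f g h = minor (X 3) (Y 4) (Y 5) f g h + minor (X 2) (Y 3) (Y 5) f g h
     + minor (X 1) (Y 3) (Y 4) f g h + minor (Y 1) (Y 2) (Y 5) f g h"

definition unit_at :: "'l \<Rightarrow> 'l \<Rightarrow> 'f::field" where
  "unit_at a = (\<lambda>l. if l = a then 1 else 0)"

text \<open>A nonzero term of the determinant would match the three unit rows bijectively with the
  columns \<open>p\<close>, \<open>q\<close>, \<open>r\<close>, which makes the two multisets
  equal.\<close>

lemma minor_unit_eq_0:
  assumes "{#a, b, c#} \<noteq> {#p, q, r#}" "p \<noteq> q" "p \<noteq> r" "q \<noteq> r"
  shows "minor p q r (unit_at a) (unit_at b) (unit_at c) = 0"
  using assms unfolding minor_def unit_at_def
  by (auto simp: add_mset_commute)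

lemma minor_swap12: "minor p q r g f h = - minor p q r f g h"
  and minor_swap23: "minor p q r f h g = - minor p q r f g h"
  and minor_eq_0: "minor p q r f f h = 0"
  unfolding minor_def by (simp_all add: algebra_simps)

lemma vol_swap12: "vol g f h = - vol f g h"
  and vol_swap23: "vol f h g = - vol f g h"
  unfolding vol_def minor_swap12[of _ _ _ g f] minor_swap23[of _ _ _ f h g] by simp_all

lemma vol_eq_0: "vol f f h = 0"
  unfolding vol_def by (simp add: minor_eq_0)

lemma mset3_eqD:
  assumes "{#a, b, c#} = {#p, q, r#}"
  shows "(a, b, c) \<in> {(p, q, r), (p, r, q), (q, p, r), (q, r, p), (r, p, q), (r, q, p)}"
  using assms by (auto simp: add_eq_conv_ex)

lemma numeral_interval_5: "{1..5::nat} = {1, 2, 3, 4, 5}"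
  by auto

lemma labels_5: "labels 5 = {X 1, X 2, X 3, X 4, X 5, Y 1, Y 2, Y 3, Y 4, Y 5}"
  unfolding labels_def numeral_interval_5 by auto

lemma finite_labels: "finite (labels n)"
  by (simp add: labels_def)

lemma card_labels: "card (labels n) = 2 * n"
proof -
  have "card (X ` {1..n}) = n" "card (Y ` {1..n}) = n"
    by (simp_all add: card_image inj_on_def)
  moreover have "X ` {1..n} \<inter> Y ` {1..n} = {}" by auto
  ultimately show ?thesis
    unfolding labels_def by (subst card_Un_disjoint) auto
qed

text \<open>Coordinate functions are controlled only on \<open>labels 5\<close>, and
  \<open>vol\<close> evaluates them nowhere else.\<close>

lemma vol_cong:
  assumes "\<And>l. l \<in> labels 5 \<Longrightarrow> f l = f' l" "\<And>l. l \<in> labels 5 \<Longrightarrow> g l = g' l"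
    "\<And>l. l \<in> labels 5 \<Longrightarrow> h l = h' l"
  shows "vol f g h = vol f' g' h'"
  using assms by (simp add: vol_def minor_def labels_5)

section \<open>Bilinear algebra and standard bases\<close>

context symplectic_alternating_algebra
begin

definition tri :: "'v \<Rightarrow> 'v \<Rightarrow> 'v \<Rightarrow> 'f" where
  "tri u v w = form (u \<cdot> v) w"

lemma form_add_left: "form (u + u') v = form u v + form u' v"
  and form_scale_left: "form (scale c u) v = c * form u v"
  using form_linear_left[of v] by (simp_all add: Vector_Spaces.linear_iff)

lemma form_add_right: "form u (v + v') = form u v + form u v'"
  and form_scale_right: "form u (scale c v) = c * form u v"
  using form_linear_right[of u] by (simp_all add: Vector_Spaces.linear_iff)

lemma mul_add_left: "(u + u') \<cdot> v = u \<cdot> v + u' \<cdot> v"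
  and mul_scale_left: "scale c u \<cdot> v = scale c (u \<cdot> v)"
  using mul_linear_left[of v] by (simp_all add: Vector_Spaces.linear_iff)

lemma mul_add_right: "u \<cdot> (v + v') = u \<cdot> v + u \<cdot> v'"
  and mul_scale_right: "u \<cdot> scale c v = scale c (u \<cdot> v)"
  using mul_linear_right[of u] by (simp_all add: Vector_Spaces.linear_iff)

lemma form_zero_left [simp]: "form 0 v = 0" and form_zero_right [simp]: "form v 0 = 0"
  using form_scale_left[of 0 0 v] form_scale_right[of v 0 0] by simp_all

lemma mul_zero_left [simp]: "0 \<cdot> v = 0" and mul_zero_right [simp]: "v \<cdot> 0 = 0"
  using mul_scale_left[of 0 0 v] mul_scale_right[of v 0 0] by simp_all

lemma form_minus_left: "form (- u) v = - form u v"
  using form_scale_left[of "-1" u v] by simp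

lemma form_minus_right: "form u (- v) = - form u v"
  using form_scale_right[of u "-1" v] by simp

lemma mul_minus_left: "(- u) \<cdot> v = - (u \<cdot> v)"
  using mul_scale_left[of "-1" u v] by simp

lemma mul_minus_right: "u \<cdot> (- v) = - (u \<cdot> v)"
  using mul_scale_right[of u "-1" v] by simp

lemma form_diff_left: "form (u - u') v = form u v - form u' v"
  using form_add_left[of u "- u'" v] by (simp add: form_minus_left)

lemma form_diff_right: "form u (v - v') = form u v - form u v'"
  using form_add_right[of u v "- v'"] by (simp add: form_minus_right)

lemma mul_diff_left: "(u - u') \<cdot> v = u \<cdot> v - u' \<cdot> v"
  using mul_add_left[of u "- u'" v] by (simp add: mul_minus_left)

lemma mul_diff_right: "u \<cdot> (v - v') = u \<cdot> v - u \<cdot> v'"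
  using mul_add_right[of u v "- v'"] by (simp add: mul_minus_right)

lemmas bilinear_simps =
  form_add_left form_add_right form_scale_left form_scale_right form_minus_left form_minus_right
  form_diff_left form_diff_right mul_add_left mul_add_right mul_scale_left mul_scale_right
  mul_minus_left mul_minus_right mul_diff_left mul_diff_right

lemma form_skew: "form v u = - form u v"
proof -
  have "form v u + form u v = 0"
    using form_alternating[of "u + v"] unfolding bilinear_simps
    by (simp add: form_alternating add.commute)
  then show ?thesis by (rule eq_neg_iff_add_eq_0[THEN iffD2])
qed

lemma mul_skew: "v \<cdot> u = - (u \<cdot> v)"
proof -
  have "v \<cdot> u + u \<cdot> v = 0"
    using mul_alternating[of "u + v"] unfolding bilinear_simps
    by (simp add: mul_alternating add.commute)
  then show ?thesis by (rule eq_neg_iff_add_eq_0[THEN iffD2])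
qed

lemma tri_swap12: "tri v u w = - tri u v w"
  unfolding tri_def mul_skew[of v u] by (simp add: bilinear_simps)

lemma tri_cyclic: "tri u v w = tri v w u"
  unfolding tri_def by (rule form_mul_cyclic)

lemma tri_swap23: "tri u w v = - tri u v w"
  using tri_swap12[of u w v] by (simp add: tri_cyclic)

lemma tri_eq_0: "tri u u w = 0" "tri u w u = 0" "tri w u u = 0"
  using tri_cyclic[of u u w] tri_cyclic[of w u u]
  by (simp_all add: tri_def mul_alternating)

text \<open>Right multiplication by \<open>c\<close> is self-adjoint: the sign from the skew form
  cancels the sign from the skew product. This moves factors across the form in all orthogonality
  arguments.\<close>

lemma form_mul_right: "form u (v \<cdot> c) = form (u \<cdot> c) v"
  using form_mul_cyclic[of v c u] mul_skew[of c u]  form_skew[of u "v \<cdot> c"]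
  by (simp add: bilinear_simps)

lemma form_eqI: "(\<And>w. form u w = form v w) \<Longrightarrow> u = v"
  using form_nondegenerate[of "u - v"] by (simp add: bilinear_simps)

text \<open>Coefficients are extracted by pairing with the dual vector; the minus sign comes from
  \<open>form (y i) (x i) = -1\<close>.\<close>

definition coord :: "(nat \<Rightarrow> 'v) \<Rightarrow> (nat \<Rightarrow> 'v) \<Rightarrow> 'v \<Rightarrow> label \<Rightarrow> 'f" where
  "coord x y u l = (case l of X i \<Rightarrow> form u (y i) | Y i \<Rightarrow> - form u (x i))"

lemma coord_simps: "coord x y u (X i) = form u (y i)" "coord x y u (Y i) = - form u (x i)"
  by (simp_all add: coord_def)

text \<open>The form relations of a standard basis alone. Independence follows from them, and so
  does spanning once the dimension is \<open>2 * n\<close>.\<close>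

definition hyperbolic :: "nat \<Rightarrow> (nat \<Rightarrow> 'v) \<Rightarrow> (nat \<Rightarrow> 'v) \<Rightarrow> bool" where
  "hyperbolic n x y \<longleftrightarrow> (\<forall>i\<in>{1..n}. \<forall>j\<in>{1..n}.
     form (x i) (x j) = 0 \<and> form (y i) (y j) = 0 \<and> form (x i) (y j) = (if i = j then 1 else 0))"

lemma standard_basis_hyperbolic: "standard_basis n x y \<Longrightarrow> hyperbolic n x y"
  by (simp add: standard_basis_def hyperbolic_def)

lemma hyperbolic_forms:
  assumes "hyperbolic n x y" "i \<in> {1..n}" "j \<in> {1..n}"
  shows "form (x i) (x j) = 0" "form (y i) (y j) = 0"
    "form (x i) (y j) = (if i = j then 1 else 0)" "form (y i) (x j) = (if i = j then -1 else 0)"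
  using assms form_skew[of "y i" "x j"] by (auto simp: hyperbolic_def)

lemma coord_basis:
  assumes "hyperbolic n x y" "a \<in> labels n" "b \<in> labels n"
  shows "coord x y (basis_elem x y a) b = unit_at a b"
  using assms(2,3) unfolding labels_def unit_at_def
  by (elim UnE imageE) (simp_all add: coord_simps hyperbolic_forms[OF assms(1)])

lemma coord_add: "coord x y (u + v) l = coord x y u l + coord x y v l"
  and coord_scale: "coord x y (scale c u) l = c * coord x y u l"
  and coord_diff: "coord x y (u - v) l = coord x y u l - coord x y v l"
  and coord_zero: "coord x y 0 l = 0"
  by (simp_all add: coord_def bilinear_simps split: label.split)

lemma coord_sum: "coord x y (sum f A) l = (\<Sum>a\<in>A. coord x y (f a) l)"
  by (induction A rule: infinite_finite_induct) (simp_all add: coord_add coord_zero)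

lemma form_sum_left: "form (sum f A) v = (\<Sum>a\<in>A. form (f a) v)"
  by (induction A rule: infinite_finite_induct) (simp_all add: bilinear_simps)

lemma inj_on_basis_elem:
  assumes "hyperbolic n x y"
  shows "inj_on (basis_elem x y) (labels n)"
proof (rule inj_onI)
  fix a b assume *: "a \<in> labels n" "b \<in> labels n" "basis_elem x y a = basis_elem x y b"
  then have "unit_at a b = (unit_at b b :: 'f)"
    using coord_basis[OF assms, of a b] coord_basis[OF assms, of b b] by simp
  then show "a = b" by (simp add: unit_at_def split: if_splits)
qed

text \<open>Taking \<open>coord\<close> of a vanishing linear combination isolates each of its
  coefficients.\<close>

lemma independent_basis_elem:
  assumes hyp: "hyperbolic n x y" and A: "A \<subseteq> labels n"
  shows "independent (basis_elem x y ` A)"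
proof -
  have fin: "finite A" using A finite_labels finite_subset by blast
  have inj: "inj_on (basis_elem x y) A"
    using inj_on_basis_elem[OF hyp] A by (rule inj_on_subset)
  show ?thesis
  proof (subst dependent_finite)
    show "finite (basis_elem x y ` A)" using fin by simp
    show "\<nexists>u. (\<exists>v\<in>basis_elem x y ` A. u v \<noteq> 0) \<and> (\<Sum>v\<in>basis_elem x y ` A. scale (u v) v) = 0"
    proof (clarsimp)
      fix u b
      assume b: "b \<in> A" "u (basis_elem x y b) \<noteq> 0"
        and "(\<Sum>v\<in>basis_elem x y ` A. scale (u v) v) = 0"
      then have 0: "(\<Sum>a\<in>A. scale (u (basis_elem x y a)) (basis_elem x y a)) = 0"
        by (simp add: sum.reindex[OF inj])
      have "0 = (\<Sum>a\<in>A. u (basis_elem x y a) * coord x y (basis_elem x y a) b)"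
        using arg_cong[OF 0, of "\<lambda>v. coord x y v b"] by (simp add: coord_sum coord_scale coord_zero)
      also have "\<dots> = (\<Sum>a\<in>A. if a = b then u (basis_elem x y b) else 0)"
        using A b by (intro sum.cong) (auto simp: coord_basis[OF hyp] unit_at_def subset_iff)
      also have "\<dots> = u (basis_elem x y b)" using fin b by simp
      finally show False using b by simp
    qed
  qed
qed

text \<open>A basis chosen inside the given finite spanning set makes the dimension theory of
  \<open>finite_dimensional_vector_space\<close> available.\<close>

lemma ex_finite_dimensional: "\<exists>B. finite_dimensional_vector_space scale B"
proof -
  obtain C where C: "finite C" "span C = UNIV" using finite_dim by blast
  obtain B where B: "B \<subseteq> C" "independent B" "C \<subseteq> span B"
    by (rule maximal_independent_subset)
  have "span C \<subseteq> span B" using B(3) by (rule span_minimal) (rule subspace_span)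
  with B C show ?thesis
    by (intro exI[of _ B] finite_dimensional_vector_space.intro vector_space_axioms
        finite_dimensional_vector_space_axioms.intro) (auto intro: finite_subset)
qed

lemma standard_basis_if_hyperbolic:
  assumes hyp: "hyperbolic n x y" and dim: "dim (UNIV :: 'v set) = 2 * n"
  shows "standard_basis n x y"
proof -
  obtain B where "finite_dimensional_vector_space scale B" using ex_finite_dimensional by blast
  then interpret finite_dimensional_vector_space scale B .
  have "card (basis_elem x y ` labels n) = dim (UNIV :: 'v set)"
    by (simp only: card_image[OF inj_on_basis_elem[OF hyp]] card_labels dim)
  then have "span (basis_elem x y ` labels n) = UNIV"
    using independent_basis_elem[OF hyp subset_refl]
    by (metis card_ge_dim_independent order_refl subset_UNIV top.extremum_uniqueI)
  then show ?thesis
    using inj_on_basis_elem[OF hyp] independent_basis_elem[OF hyp subset_refl] hyp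
    by (simp add: standard_basis_def hyperbolic_def)
qed

lemma basis_vanish:
  assumes "standard_basis n x y" "f 0 = (0::'f)" "\<And>u v. f (u + v) = f u + f v"
    "\<And>c u. f (scale c u) = c * f u" "\<And>a. a \<in> labels n \<Longrightarrow> f (basis_elem x y a) = 0"
  shows "f u = 0"
proof -
  have "u \<in> span (basis_elem x y ` labels n)"
    using assms(1) by (simp add: standard_basis_def)
  then show ?thesis
    by (induction rule: span_induct) (auto simp: subspace_def assms(2-))
qed

section \<open>The presentation as a formula for all triple values\<close>

lemma tri_eq_vol_if_basis:
  assumes sb: "standard_basis 5 x y"
    and eq: "\<And>a b c. a \<in> labels 5 \<Longrightarrow> b \<in> labels 5 \<Longrightarrow> c \<in> labels 5 \<Longrightarrow>
      tri (basis_elem x y a) (basis_elem x y b) (basis_elem x y c)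
        = vol (unit_at a) (unit_at b) (unit_at c)"
  shows "tri u v w = vol (coord x y u) (coord x y v) (coord x y w)"
proof -
  \<comment> \<open>The difference \<open>D\<close> is trilinear. Once it vanishes on basis triples,
    \<open>basis_vanish\<close> frees one argument at a time.\<close>
  define D where "D u v w = tri u v w - vol (coord x y u) (coord x y v) (coord x y w)" for u v w
  have vol_units: "vol (coord x y (basis_elem x y a)) (coord x y (basis_elem x y b))
      (coord x y (basis_elem x y c)) = vol (unit_at a) (unit_at b) (unit_at c)"
    if "a \<in> labels 5" "b \<in> labels 5" "c \<in> labels 5" for a b c
    using that coord_basis[OF standard_basis_hyperbolic[OF sb]] by (intro vol_cong) auto
  have 0: "D (basis_elem x y a) (basis_elem x y b) (basis_elem x y c) = 0"
    if "a \<in> labels 5" "b \<in> labels 5" "c \<in> labels 5" for a b c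
    using that unfolding D_def by (simp add: vol_units eq)
  have lin: "D 0 v w = 0" "D (u + u') v w = D u v w + D u' v w" "D (scale c u) v w = c * D u v w"
    "D v 0 w = 0" "D v (u + u') w = D v u w + D v u' w" "D v (scale c u) w = c * D v u w"
    "D v w 0 = 0" "D v w (u + u') = D v w u + D v w u'" "D v w (scale c u) = c * D v w u"
    for u u' v w c
    unfolding D_def tri_def vol_def minor_def coord_simps
    by (simp_all add: bilinear_simps algebra_simps)
  have 1: "D u (basis_elem x y b) (basis_elem x y c) = 0"
    if "b \<in> labels 5" "c \<in> labels 5" for u b c
    by (rule basis_vanish[OF sb, of "\<lambda>u. D u _ _"]) (simp_all add: lin 0 that)
  have 2: "D u v (basis_elem x y c) = 0" if "c \<in> labels 5" for u v c
    by (rule basis_vanish[OF sb, of "\<lambda>v. D _ v _"]) (simp_all add: lin 1 that)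
  have "D u v w = 0"
    by (rule basis_vanish[OF sb, of "\<lambda>w. D _ _ w"]) (simp_all add: lin 2)
  then show ?thesis by (simp add: D_def)
qed


text \<open>A basis triple either rearranges exactly one listed triple or has value 0 on both sides,
  so the entries together with the convention on unlisted triples amount to a single trilinear
  identity.\<close>

lemma has_presentation_iff:
  "has_presentation 5 x y P10_2_1 \<longleftrightarrow> standard_basis 5 x y \<and>
     (\<forall>u v w. tri u v w = vol (coord x y u) (coord x y v) (coord x y w))"
  (is "?P \<longleftrightarrow> ?Q")
proof
  assume P: ?P
  then have sb: "standard_basis 5 x y" by (simp add: has_presentation_def)
  let ?e = "basis_elem x y"
  have listed: "tri (?e (X 3)) (?e (Y 4)) (?e (Y 5)) = 1" "tri (?e (X 2)) (?e (Y 3)) (?e (Y 5)) = 1"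
    "tri (?e (X 1)) (?e (Y 3)) (?e (Y 4)) = 1" "tri (?e (Y 1)) (?e (Y 2)) (?e (Y 5)) = 1"
    using P by (auto simp: has_presentation_def P10_2_1_def tri_def)
  have perms: "tri (?e a) (?e b) (?e c) = minor p q r (unit_at a) (unit_at b) (unit_at c)"
    if t: "tri (?e p) (?e q) (?e r) = 1" and "p \<noteq> q" "p \<noteq> r" "q \<noteq> r" and m: "{#a, b, c#} = {#p, q, r#}"
    for a b c p q r
  proof -
    \<comment> \<open>Three distinct labels have six orderings; transpositions give the other five
      values from the listed one.\<close>
    have *: "tri (?e p) (?e r) (?e q) = -1" "tri (?e q) (?e p) (?e r) = -1"
      "tri (?e q) (?e r) (?e p) = 1" "tri (?e r) (?e p) (?e q) = 1" "tri (?e r) (?e q) (?e p) = -1"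
      using t tri_swap12 tri_swap23 by metis+
    show ?thesis
      using mset3_eqD[OF m] that(2-4) t *
      by (auto simp: minor_def unit_at_def)
  qed
  have "tri (?e a) (?e b) (?e c) = vol (unit_at a) (unit_at b) (unit_at c)"
    if l: "a \<in> labels 5" "b \<in> labels 5" "c \<in> labels 5" for a b c
  proof (cases "{#a, b, c#} \<in> {{#X 3, Y 4, Y 5#}, {#X 2, Y 3, Y 5#}, {#X 1, Y 3, Y 4#}, {#Y 1, Y 2, Y 5#}}")
    case False
    then have "tri (?e a) (?e b) (?e c) = 0"
      using P l by (auto simp: has_presentation_def P10_2_1_def tri_def)
    moreover have "vol (unit_at a) (unit_at b) (unit_at c) = (0::'f)"
      using False unfolding vol_def by (simp add: minor_unit_eq_0)
    ultimately show ?thesis by simp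
  next
    case True
    \<comment> \<open>The listed multisets are pairwise different, so three of the four minors in
      \<open>vol\<close> vanish.\<close>
    have neq: "{#X 3, Y 4, Y 5#} \<noteq> {#X 2, Y 3, Y 5#}" "{#X 3, Y 4, Y 5#} \<noteq> {#X 1, Y 3, Y 4#}"
      "{#X 3, Y 4, Y 5#} \<noteq> {#Y 1, Y 2, Y 5#}" "{#X 2, Y 3, Y 5#} \<noteq> {#X 1, Y 3, Y 4#}"
      "{#X 2, Y 3, Y 5#} \<noteq> {#Y 1, Y 2, Y 5#}" "{#X 1, Y 3, Y 4#} \<noteq> {#Y 1, Y 2, Y 5#}"
      by (auto simp: add_eq_conv_ex)
    from True consider "{#a, b, c#} = {#X 3, Y 4, Y 5#}" | "{#a, b, c#} = {#X 2, Y 3, Y 5#}"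
      | "{#a, b, c#} = {#X 1, Y 3, Y 4#}" | "{#a, b, c#} = {#Y 1, Y 2, Y 5#}"
      by blast
    then show ?thesis
      unfolding vol_def
      by cases (simp_all add: perms[OF listed(1)] perms[OF listed(2)] perms[OF listed(3)]
        perms[OF listed(4)] minor_unit_eq_0 neq neq[symmetric]
        del: One_nat_def)
  qed
  from tri_eq_vol_if_basis[OF sb this] sb show ?Q by blast
next
  assume Q: ?Q
  then have sb: "standard_basis 5 x y" by blast
  have tri: "tri (basis_elem x y a) (basis_elem x y b) (basis_elem x y c)
      = vol (unit_at a) (unit_at b) (unit_at c)"
    if "a \<in> labels 5" "b \<in> labels 5" "c \<in> labels 5" for a b c
    using that coord_basis[OF standard_basis_hyperbolic[OF sb]] Q by (auto intro!: vol_cong)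
  have "vol (unit_at a) (unit_at b) (unit_at c) = (0::'f)"
    if "\<forall>(a', b', c', r :: 'f)\<in>P10_2_1. {#a, b, c#} \<noteq> {#a', b', c'#}" for a b c
    using that unfolding vol_def P10_2_1_def by (simp add: minor_unit_eq_0)
  then have unlisted: "\<forall>a\<in>labels 5. \<forall>b\<in>labels 5. \<forall>c\<in>labels 5.
      (\<forall>(a', b', c', r :: 'f)\<in>P10_2_1. {#a, b, c#} \<noteq> {#a', b', c'#}) \<longrightarrow>
      tri (basis_elem x y a) (basis_elem x y b) (basis_elem x y c) = 0"
    using tri by simp
  have "X 3 \<in> labels 5" "X 2 \<in> labels 5" "X 1 \<in> labels 5" "Y 1 \<in> labels 5" "Y 2 \<in> labels 5"
    "Y 3 \<in> labels 5" "Y 4 \<in> labels 5" "Y 5 \<in> labels 5"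
    by (simp_all add: labels_def)
  then have "\<forall>(a, b, c, r)\<in>P10_2_1. tri (basis_elem x y a) (basis_elem x y b) (basis_elem x y c) = r"
    unfolding P10_2_1_def
    by (simp add: tri del: basis_elem.simps One_nat_def) (simp add: vol_def minor_def unit_at_def)
  with unlisted sb show ?P
    by (simp add: has_presentation_def tri_def)
qed


section \<open>Recovering vectors and the form from coordinates\<close>

lemma standard_basis_form_eq_0D:
  assumes "standard_basis n x y" "\<And>l. l \<in> labels n \<Longrightarrow> coord x y u l = 0"
  shows "u = 0"
proof (rule form_nondegenerate)
  fix v
  have "form u (x i) = 0" "form u (y i) = 0" if "i \<in> {1..n}" for i
    using that assms(2)[of "X i"] assms(2)[of "Y i"] by (simp_all add: labels_def coord_simps)
  then have "form u (basis_elem x y a) = 0" if "a \<in> labels n" for a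
    using that by (auto simp: labels_def)
  then show "form u v = 0"
    by (rule basis_vanish[OF assms(1) form_zero_right form_add_right form_scale_right])
qed

text \<open>For a standard basis this is inverse to \<open>coord\<close> on
  \<open>labels n\<close>.\<close>

definition combine :: "nat \<Rightarrow> (nat \<Rightarrow> 'v) \<Rightarrow> (nat \<Rightarrow> 'v) \<Rightarrow> (label \<Rightarrow> 'f) \<Rightarrow> 'v" where
  "combine n x y f = (\<Sum>l\<in>labels n. scale (f l) (basis_elem x y l))"

lemma coord_combine:
  assumes "hyperbolic n x y" "b \<in> labels n"
  shows "coord x y (combine n x y f) b = f b"
proof -
  have "coord x y (combine n x y f) b = (\<Sum>a\<in>labels n. f a * coord x y (basis_elem x y a) b)"
    by (simp add: combine_def coord_sum coord_scale)
  also have "\<dots> = (\<Sum>a\<in>labels n. if a = b then f b else 0)"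
    using assms by (intro sum.cong) (auto simp: coord_basis unit_at_def)
  finally show ?thesis using assms finite_labels by simp
qed

lemma combine_coord:
  assumes "standard_basis n x y"
  shows "combine n x y (coord x y u) = u"
proof -
  have "coord x y (combine n x y (coord x y u) - u) l = 0" if "l \<in> labels n" for l
    unfolding coord_diff coord_combine[OF standard_basis_hyperbolic[OF assms] that] by simp
  from standard_basis_form_eq_0D[OF assms this] show ?thesis
    unfolding right_minus_eq .
qed

lemma form_eq_coord:
  assumes "standard_basis n x y"
  shows "form u v = (\<Sum>i\<in>{1..n}. coord x y u (X i) * coord x y v (Y i)
    - coord x y u (Y i) * coord x y v (X i))"
proof -
  let ?c = "coord x y u"
  have "form u v = form (combine n x y ?c) v"
    by (simp only: combine_coord[OF assms])
  also have "\<dots> = (\<Sum>l\<in>labels n. ?c l * form (basis_elem x y l) v)"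
    by (simp add: combine_def form_sum_left form_scale_left)
  also have "\<dots> = (\<Sum>l\<in>X ` {1..n}. ?c l * form (basis_elem x y l) v)
      + (\<Sum>l\<in>Y ` {1..n}. ?c l * form (basis_elem x y l) v)"
    unfolding labels_def by (rule sum.union_disjoint) auto
  also have "\<dots> = (\<Sum>i\<in>{1..n}. ?c (X i) * form (x i) v) + (\<Sum>i\<in>{1..n}. ?c (Y i) * form (y i) v)"
    by (simp add: sum.reindex inj_on_def)
  also have "\<dots> = (\<Sum>i\<in>{1..n}. ?c (X i) * form (x i) v + ?c (Y i) * form (y i) v)"
    by (simp add: sum.distrib)
  also have "\<dots> = (\<Sum>i\<in>{1..n}. ?c (X i) * coord x y v (Y i) - ?c (Y i) * coord x y v (X i))"
    by (intro sum.cong refl) (simp add: coord_simps(1,2)[of x y v] form_skew[of v "x _"] form_skew[of v "y _"])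
  finally show ?thesis .
qed

end

section \<open>Isomorphism of presented algebras\<close>

lemma saa_isomorphic_if_presented:
  fixes scale :: "'f::field \<Rightarrow> 'v::ab_group_add \<Rightarrow> 'v"
    and scale' :: "'f \<Rightarrow> 'w::ab_group_add \<Rightarrow> 'w"
  assumes "saa_P10_2_1 scale mul form" "saa_P10_2_1 scale' mul' form'"
  shows "saa_isomorphic scale mul form scale' mul' form'"
proof -
  interpret A: saa_P10_2_1 scale mul form by fact
  interpret B: saa_P10_2_1 scale' mul' form' by fact
  obtain x y where A: "A.standard_basis 5 x y"
    "\<And>u v w. form (mul u v) w = vol (A.coord x y u) (A.coord x y v) (A.coord x y w)"
    using A.presented unfolding A.has_presentation_iff A.tri_def by blast
  obtain x' y' where B: "B.standard_basis 5 x' y'"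
    "\<And>u v w. form' (mul' u v) w = vol (B.coord x' y' u) (B.coord x' y' v) (B.coord x' y' w)"
    using B.presented unfolding B.has_presentation_iff B.tri_def by blast
  note Ah = A.standard_basis_hyperbolic[OF A(1)] and Bh = B.standard_basis_hyperbolic[OF B(1)]
  \<comment> \<open>The isomorphism matches vectors with equal coordinates, and
    \<open>\<psi>\<close> is its inverse.\<close>
  define \<phi> where "\<phi> u = B.combine 5 x' y' (A.coord x y u)" for u
  define \<psi> where "\<psi> u = A.combine 5 x y (B.coord x' y' u)" for u
  have coord_\<phi>: "B.coord x' y' (\<phi> u) l = A.coord x y u l" if "l \<in> labels 5" for u l
    unfolding \<phi>_def using Bh that by (rule B.coord_combine)
  have coord_\<psi>: "A.coord x y (\<psi> u) l = B.coord x' y' u l" if "l \<in> labels 5" for u l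
    unfolding \<psi>_def using Ah that by (rule A.coord_combine)
  have \<psi>\<phi>: "\<psi> (\<phi> u) = u" for u
  proof -
    have "\<psi> (\<phi> u) = A.combine 5 x y (A.coord x y u)"
      unfolding \<psi>_def A.combine_def by (intro sum.cong refl) (simp add: coord_\<phi>)
    then show ?thesis by (simp add: A.combine_coord[OF A(1)])
  qed
  have \<phi>\<psi>: "\<phi> (\<psi> u) = u" for u
  proof -
    have "\<phi> (\<psi> u) = B.combine 5 x' y' (B.coord x' y' u)"
      unfolding \<phi>_def B.combine_def by (intro sum.cong refl) (simp add: coord_\<psi>)
    then show ?thesis by (simp add: B.combine_coord[OF B(1)])
  qed
  have bij: "bij \<phi>"
    by (rule o_bij[of \<psi>]) (auto simp: fun_eq_iff \<psi>\<phi> \<phi>\<psi>)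
  have vs: "vector_space scale" "vector_space scale'" by unfold_locales
  have lin: "Vector_Spaces.linear scale scale' \<phi>"
    unfolding Vector_Spaces.linear_iff
  proof (intro conjI vs allI)
    show "\<phi> (u + v) = \<phi> u + \<phi> v" for u v
      unfolding \<phi>_def B.combine_def A.coord_add B.scale_left_distrib sum.distrib ..
    show "\<phi> (scale c u) = scale' c (\<phi> u)" for c u
      unfolding \<phi>_def B.combine_def A.coord_scale B.scale_sum_right B.scale_scale ..
  qed
  have form: "form' (\<phi> u) (\<phi> v) = form u v" for u v
    unfolding A.form_eq_coord[OF A(1), of u v] B.form_eq_coord[OF B(1), of "\<phi> u" "\<phi> v"]
    by (intro sum.cong refl) (simp add: coord_\<phi> labels_def)
  \<comment> \<open>By nondegeneracy a product is determined by its form values. As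
    \<open>\<phi>\<close> is onto, these can be tested on \<open>\<phi> (\<psi> w)\<close>, where
    both sides are the same value of \<open>vol\<close>.\<close>
  have mul: "\<phi> (mul u v) = mul' (\<phi> u) (\<phi> v)" for u v
  proof (rule B.form_eqI)
    fix w
    have "form' (mul' (\<phi> u) (\<phi> v)) (\<phi> (\<psi> w)) = form' (\<phi> (mul u v)) (\<phi> (\<psi> w))"
      unfolding B(2) form A(2) by (rule vol_cong) (simp_all add: coord_\<phi>)
    then show "form' (\<phi> (mul u v)) w = form' (mul' (\<phi> u) (\<phi> v)) w"
      by (simp add: \<phi>\<psi>)
  qed
  show ?thesis
    unfolding saa_isomorphic_def by (intro exI[of _ \<phi>] conjI allI lin bij form mul)
qed


section \<open>Lower central series of the presented algebra\<close>

context symplectic_alternating_algebra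
begin

section \<open>General facts on the lower central series\<close>

lemma subspace_prod_subset:
  assumes "subspace S" "\<And>u v. u \<in> U \<Longrightarrow> v \<in> V \<Longrightarrow> u \<cdot> v \<in> S"
  shows "subspace_prod U V \<subseteq> S"
  unfolding subspace_prod_def using assms by (intro span_minimal) auto

lemma mul_in_subspace_prod: "u \<in> U \<Longrightarrow> v \<in> V \<Longrightarrow> u \<cdot> v \<in> subspace_prod U V"
  unfolding subspace_prod_def by (rule span_base) blast

lemma lower_central_Suc:
  "k > 0 \<Longrightarrow> lower_central (Suc k) = subspace_prod (lower_central k) UNIV"
  by (cases k) auto

lemma mul_in_lower_central:
  "k > 0 \<Longrightarrow> u \<in> lower_central k \<Longrightarrow> u \<cdot> v \<in> lower_central (Suc k)"
  by (simp add: lower_central_Suc mul_in_subspace_prod)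

lemma subspace_lower_central: "subspace (lower_central k)"
proof (cases "k \<le> 1")
  case True
  then have "lower_central k = UNIV" by (cases k) auto
  then show ?thesis by simp
next
  case False
  then obtain j where "k = Suc (Suc j)" by (metis One_nat_def Suc_le_mono le0 old.nat.exhaust)
  then show ?thesis by (simp add: subspace_prod_def)
qed

text \<open>Multiplication by \<open>UNIV\<close> preserves inclusions, which gives the induction.
  The placeholder value \<open>UNIV\<close> at index 0 keeps the statement true there too.\<close>

lemma lower_central_antimono_Suc: "lower_central (Suc k) \<subseteq> lower_central k"
proof (induction k)
  case (Suc k)
  show ?case
  proof (cases "k = 0")
    case False
    then show ?thesis
      unfolding lower_central_Suc[of "Suc k", OF zero_less_Suc]
      using Suc.IH by (intro subspace_prod_subset subspace_lower_central) (auto intro: mul_in_lower_central)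
  qed simp
qed simp

lemma lower_central_antimono: "j \<le> k \<Longrightarrow> lower_central k \<subseteq> lower_central j"
  by (rule lift_Suc_antimono_le[of lower_central]) (rule lower_central_antimono_Suc)

lemma zero_in_lower_central: "0 \<in> lower_central k"
  by (rule subspace_0[OF subspace_lower_central])

lemma lower_central_eq_0_mono: "lower_central j = {0} \<Longrightarrow> j \<le> k \<Longrightarrow> lower_central k = {0}"
  using lower_central_antimono[of j k] zero_in_lower_central[of k] by auto

text \<open>The terms decrease, so if a term of smaller index than \<open>Suc k\<close> vanished,
  then so would term \<open>k\<close>.\<close>

lemma nilpotency_class_eqI:
  assumes "lower_central (Suc k) = {0}" "lower_central k \<noteq> {0}"
  shows "nilpotent" "nilpotency_class = k"
proof -
  show "nilpotent" unfolding nilpotent_def using assms(1) by auto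
  have "k \<le> j" if "lower_central (j + 1) = {0}" for j
    using lower_central_eq_0_mono[OF that, of k] assms(2) by force
  then show "nilpotency_class = k"
    unfolding nilpotency_class_def using assms(1) by (intro Least_equality) auto
qed

lemma nilpotency_class_eqD:
  assumes "nilpotent" "nilpotency_class = Suc k"
  shows "lower_central (Suc (Suc k)) = {0}" "lower_central (Suc k) \<noteq> {0}"
proof -
  have "lower_central (nilpotency_class + 1) = {0}"
    unfolding nilpotency_class_def using assms(1) unfolding nilpotent_def by (rule LeastI_ex)
  then show "lower_central (Suc (Suc k)) = {0}" by (simp add: assms(2))
  \<comment> \<open>Minimality is applied to \<open>k\<close>, one below the class; the term it
    speaks of has index \<open>k + 1\<close>.\<close>
  have "k < nilpotency_class" by (simp add: assms(2))
  from not_less_Least[OF this[unfolded nilpotency_class_def]]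
  show "lower_central (Suc k) \<noteq> {0}" by simp
qed

lemma subspace_coord_zero: "subspace {u. \<forall>l\<in>A. coord x y u l = 0}"
  by (auto simp: subspace_def coord_add coord_scale coord_zero)

section \<open>Computations in the presented algebra\<close>

context
  fixes x y :: "nat \<Rightarrow> 'v"
  assumes sb: "standard_basis 5 x y"
    and tri: "tri u v w = vol (coord x y u) (coord x y v) (coord x y w)"
begin

text \<open>Coordinates of a product are its pairings with dual basis vectors, hence triple
  values.\<close>

lemma coord_mul:
  assumes "i \<in> {1..5}"
  shows "coord x y (u \<cdot> v) (X i) = vol (coord x y u) (coord x y v) (unit_at (Y i))"
    "coord x y (u \<cdot> v) (Y i) = - vol (coord x y u) (coord x y v) (unit_at (X i))"
proof -
  have "Y i \<in> labels 5" "X i \<in> labels 5"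
    using assms by (auto simp: labels_def)
  note * = coord_basis[OF standard_basis_hyperbolic[OF sb] this(1)]
    coord_basis[OF standard_basis_hyperbolic[OF sb] this(2)]
  show "coord x y (u \<cdot> v) (X i) = vol (coord x y u) (coord x y v) (unit_at (Y i))"
    unfolding coord_simps tri[unfolded tri_def] by (rule vol_cong) (use * in simp_all)
  show "coord x y (u \<cdot> v) (Y i) = - vol (coord x y u) (coord x y v) (unit_at (X i))"
    unfolding coord_simps tri[unfolded tri_def] neg_equal_iff_equal
    by (rule vol_cong) (use * in simp_all)
qed

lemma coord_mul_X:
  "coord x y (u \<cdot> v) (X 1) = coord x y u (Y 2) * coord x y v (Y 5) - coord x y u (Y 5) * coord x y v (Y 2)"
  "coord x y (u \<cdot> v) (X 2) = coord x y u (Y 5) * coord x y v (Y 1) - coord x y u (Y 1) * coord x y v (Y 5)"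
  "coord x y (u \<cdot> v) (X 3) = coord x y u (Y 5) * coord x y v (X 2) - coord x y u (X 2) * coord x y v (Y 5)
     + (coord x y u (Y 4) * coord x y v (X 1) - coord x y u (X 1) * coord x y v (Y 4))"
  "coord x y (u \<cdot> v) (X 4) = coord x y u (Y 5) * coord x y v (X 3) - coord x y u (X 3) * coord x y v (Y 5)
     + (coord x y u (X 1) * coord x y v (Y 3) - coord x y u (Y 3) * coord x y v (X 1))"
  "coord x y (u \<cdot> v) (X 5) = coord x y u (X 3) * coord x y v (Y 4) - coord x y u (Y 4) * coord x y v (X 3)
     + (coord x y u (X 2) * coord x y v (Y 3) - coord x y u (Y 3) * coord x y v (X 2))
     + (coord x y u (Y 1) * coord x y v (Y 2) - coord x y u (Y 2) * coord x y v (Y 1))"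
  by (simp_all add: coord_mul vol_def minor_def unit_at_def algebra_simps del: One_nat_def)

text \<open>The last two vanish because \<open>X 4\<close> and \<open>X 5\<close> occur in no entry
  of the presentation.\<close>

lemma coord_mul_Y:
  "coord x y (u \<cdot> v) (Y 1) = coord x y u (Y 4) * coord x y v (Y 3) - coord x y u (Y 3) * coord x y v (Y 4)"
  "coord x y (u \<cdot> v) (Y 2) = coord x y u (Y 5) * coord x y v (Y 3) - coord x y u (Y 3) * coord x y v (Y 5)"
  "coord x y (u \<cdot> v) (Y 3) = coord x y u (Y 5) * coord x y v (Y 4) - coord x y u (Y 4) * coord x y v (Y 5)"
  "coord x y (u \<cdot> v) (Y 4) = 0"
  "coord x y (u \<cdot> v) (Y 5) = 0"
  by (simp_all add: coord_mul vol_def minor_def unit_at_def algebra_simps del: One_nat_def)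

text \<open>\<open>A\<close> and \<open>B\<close> are sets of coordinates that vanish on two
  consecutive terms of the series.\<close>

lemma lower_central_Suc_coord:
  assumes "lower_central k \<subseteq> {u. \<forall>l\<in>A. coord x y u l = 0}" "k > 0"
    and "\<And>u v. \<forall>l\<in>A. coord x y u l = 0 \<Longrightarrow> \<forall>l\<in>B. coord x y (u \<cdot> v) l = 0"
  shows "lower_central (Suc k) \<subseteq> {u. \<forall>l\<in>B. coord x y u l = 0}"
  unfolding lower_central_Suc[OF assms(2)]
  using assms(1,3) by (intro subspace_prod_subset subspace_coord_zero) blast

text \<open>Each multiplication kills further coordinates: the spaces bounding L^1 to L^7 have
  dimensions 10, 8, 7, 5, 3, 2, 0.\<close>

lemma lower_central_coords:
  "lower_central 3 \<subseteq> {u. \<forall>l\<in>{Y 3, Y 4, Y 5}. coord x y u l = 0}"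
  "lower_central 7 \<subseteq> {u. \<forall>l\<in>labels 5. coord x y u l = 0}"
proof -
  have 1: "lower_central (Suc 0) \<subseteq> {u. \<forall>l\<in>{}. coord x y u l = 0}" by simp
  have 2: "lower_central (Suc (Suc 0)) \<subseteq> {u. \<forall>l\<in>{Y 4, Y 5}. coord x y u l = 0}"
    by (rule lower_central_Suc_coord[OF 1]) (simp_all add: coord_mul_X coord_mul_Y del: One_nat_def)
  have 3: "lower_central (Suc (Suc (Suc 0))) \<subseteq> {u. \<forall>l\<in>{Y 3, Y 4, Y 5}. coord x y u l = 0}"
    by (rule lower_central_Suc_coord[OF 2]) (simp_all add: coord_mul_X coord_mul_Y del: One_nat_def)
  have 4: "lower_central (Suc (Suc (Suc (Suc 0))))
      \<subseteq> {u. \<forall>l\<in>{Y 1, Y 2, Y 3, Y 4, Y 5}. coord x y u l = 0}"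
    by (rule lower_central_Suc_coord[OF 3]) (simp_all add: coord_mul_X coord_mul_Y del: One_nat_def)
  have 5: "lower_central (Suc (Suc (Suc (Suc (Suc 0)))))
      \<subseteq> {u. \<forall>l\<in>{X 1, X 2, Y 1, Y 2, Y 3, Y 4, Y 5}. coord x y u l = 0}"
    by (rule lower_central_Suc_coord[OF 4]) (simp_all add: coord_mul_X coord_mul_Y del: One_nat_def)
  have 6: "lower_central (Suc (Suc (Suc (Suc (Suc (Suc 0))))))
      \<subseteq> {u. \<forall>l\<in>{X 1, X 2, X 3, Y 1, Y 2, Y 3, Y 4, Y 5}. coord x y u l = 0}"
    by (rule lower_central_Suc_coord[OF 5]) (simp_all add: coord_mul_X coord_mul_Y del: One_nat_def)
  have 7: "lower_central (Suc (Suc (Suc (Suc (Suc (Suc (Suc 0)))))))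
      \<subseteq> {u. \<forall>l\<in>labels 5. coord x y u l = 0}"
    by (rule lower_central_Suc_coord[OF 6])
      (simp_all add: labels_5 coord_mul_X coord_mul_Y del: One_nat_def)
  show "lower_central 3 \<subseteq> {u. \<forall>l\<in>{Y 3, Y 4, Y 5}. coord x y u l = 0}"
    "lower_central 7 \<subseteq> {u. \<forall>l\<in>labels 5. coord x y u l = 0}"
    using 3 7 by (simp_all only: eval_nat_numeral BitM.simps One_nat_def)
qed

lemma center_coords:
  "center = {u. \<forall>l\<in>{X 1, X 2, X 3, Y 1, Y 2, Y 3, Y 4, Y 5}. coord x y u l = 0}" (is "_ = ?Z")
proof
  show "?Z \<subseteq> center"
  proof (rule subsetI)
    fix u assume "u \<in> ?Z"
    then have "coord x y u (X 1) = 0" "coord x y u (X 2) = 0" "coord x y u (X 3) = 0"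
      "coord x y u (Y 1) = 0" "coord x y u (Y 2) = 0" "coord x y u (Y 3) = 0"
      "coord x y u (Y 4) = 0" "coord x y u (Y 5) = 0"
      by simp_all
    note * = coord_mul_X[of u] coord_mul_Y[of u]
      this mult_zero_left mult_zero_right diff_0_right add_0_left
    have "coord x y (u \<cdot> v) l = 0" if "l \<in> labels 5" for v l
      using that unfolding labels_5 by (elim insertE emptyE) (simp_all only: *)
    then have "u \<cdot> v = 0" for v by (rule standard_basis_form_eq_0D[OF sb])
    then show "u \<in> center" by (simp add: center_def)
  qed
  show "center \<subseteq> ?Z"
  proof (rule subsetI)
    fix u assume "u \<in> center"
    then have 0: "u \<cdot> v = 0" for v by (simp add: center_def)
    have unit: "coord x y (y i) l = unit_at (Y i) l" if "i \<in> {1..5}" "l \<in> labels 5" for i l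
      using coord_basis[OF standard_basis_hyperbolic[OF sb], of "Y i" l] that
      by (simp add: labels_def)
    have "coord x y (u \<cdot> y i) l = 0" for i l by (simp add: 0 coord_zero)
    \<comment> \<open>Each of these coordinates of a product \<open>u \<cdot> y i\<close> equals, up
      to sign, a single coordinate of \<open>u\<close>; together they cover all eight.\<close>
    note * = this[of 1 "X 2"] this[of 2 "X 1"] this[of 3 "X 4"] this[of 3 "X 5"] this[of 5 "X 4"]
      this[of 3 "Y 1"] this[of 3 "Y 2"] this[of 4 "Y 1"] this[of 1 "X 5"] this[of 2 "X 5"]
    show "u \<in> ?Z"
      using * unfolding coord_mul_X coord_mul_Y
      by (simp add: unit labels_5 unit_at_def del: One_nat_def)
  qed
qed

lemma lower_central_6_nonzero: "lower_central 6 \<noteq> {0}"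
proof
  assume 0: "lower_central 6 = {0}"
  \<comment> \<open>The partial products are \<open>y 3\<close>, \<open>- y 2\<close>,
    \<open>- x 1\<close>, \<open>x 3\<close> and finally \<open>x 5\<close>.\<close>
  define u where "u = y 5 \<cdot> y 4 \<cdot> y 5 \<cdot> y 5 \<cdot> y 4 \<cdot> y 4"
  have "y 5 \<cdot> y 4 \<in> lower_central (Suc (Suc 0))" by (rule mul_in_lower_central) simp_all
  then have "u \<in> lower_central (Suc (Suc (Suc (Suc (Suc (Suc 0))))))"
    unfolding u_def by (intro mul_in_lower_central) simp_all
  then have "u = 0" using 0 by (simp add: eval_nat_numeral)
  then have "coord x y u (X 5) = 0" by (simp add: coord_zero)
  moreover have "coord x y (y i) l = unit_at (Y i) l" if "i \<in> {1..5}" "l \<in> labels 5" for i l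
    using coord_basis[OF standard_basis_hyperbolic[OF sb], of "Y i" l] that
    by (simp add: labels_def)
  ultimately show False
    by (simp add: u_def coord_mul_X coord_mul_Y labels_5 unit_at_def del: One_nat_def)
qed

lemma lower_central_7_zero: "lower_central 7 = {0}"
proof -
  have "u = 0" if "u \<in> lower_central 7" for u
    using lower_central_coords(2) that by (intro standard_basis_form_eq_0D[OF sb]) auto
  then show ?thesis using zero_in_lower_central[of 7] by auto
qed

text \<open>Except at \<open>X 5\<close>, every term in a coordinate of a product contains a factor
  at \<open>Y 3\<close>, \<open>Y 4\<close> or \<open>Y 5\<close>, and these vanish on L^3. So only
  multiples of \<open>x 5\<close> remain.\<close>

lemma L3L3_center: "subspace_prod (lower_central 3) (lower_central 3) \<subseteq> center"
proof -
  have "u \<cdot> v \<in> center" if "u \<in> lower_central 3" "v \<in> lower_central 3" for u v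
    using that[THEN subsetD[OF lower_central_coords(1)]]
    by (simp add: center_coords coord_mul_X coord_mul_Y del: One_nat_def)
  then show ?thesis
    by (intro subspace_prod_subset) (simp_all only: center_coords subspace_coord_zero)
qed

lemma isotropic_center: "isotropic center"
  unfolding isotropic_def
proof (intro ballI)
  fix u v assume "u \<in> center" "v \<in> center"
  then show "form u v = 0"
    unfolding form_eq_coord[OF sb, of u v] center_coords
    by (simp add: numeral_interval_5 del: One_nat_def)
qed

lemma dim_center_2: "dim center = 2"
proof -
  let ?A = "{X 4, X 5}"
  note hyp = standard_basis_hyperbolic[OF sb]
  have A: "?A \<subseteq> labels 5" by (simp add: labels_5)
  have "coord x y (x i) l = unit_at (X i) l" if "i \<in> {1..5}" "l \<in> labels 5" for i l
    using coord_basis[OF hyp, of "X i" l] that by (simp add: labels_def)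
  then have sub: "basis_elem x y ` ?A \<subseteq> center"
    by (simp add: center_coords labels_5 unit_at_def del: One_nat_def)
  have "u \<in> span (basis_elem x y ` ?A)" if "u \<in> center" for u
  proof -
    have "u = (\<Sum>l\<in>labels 5. scale (coord x y u l) (basis_elem x y l))"
      using combine_coord[OF sb, of u] by (simp add: combine_def)
    also have "\<dots> = (\<Sum>l\<in>?A. scale (coord x y u l) (basis_elem x y l))"
      using A that by (intro sum.mono_neutral_right finite_labels)
        (auto simp: center_coords labels_5 simp del: One_nat_def)
    also have "\<dots> \<in> span (basis_elem x y ` ?A)"
      by (intro span_sum span_scale span_base) auto
    finally show ?thesis .
  qed
  moreover have "card (basis_elem x y ` ?A) = 2"
    by (subst card_image[OF inj_on_subset[OF inj_on_basis_elem[OF hyp] A]]) simp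
  ultimately show ?thesis
    using sub independent_basis_elem[OF hyp A] by (intro dim_unique) auto
qed

lemma dim_UNIV_10: "dim (UNIV :: 'v set) = 10"
proof -
  note hyp = standard_basis_hyperbolic[OF sb]
  have "card (basis_elem x y ` labels 5) = 10"
    by (simp only: card_image[OF inj_on_basis_elem[OF hyp]] card_labels)
  moreover have "independent (basis_elem x y ` labels 5)" "span (basis_elem x y ` labels 5) = UNIV"
    using sb unfolding standard_basis_def by blast+
  ultimately show ?thesis
    by (intro dim_unique[of "basis_elem x y ` labels 5"]) simp_all
qed

end

end

lemma saa_dim10_class6_if_presented:
  fixes scale :: "'f::field \<Rightarrow> 'v::ab_group_add \<Rightarrow> 'v"
  assumes "saa_P10_2_1 scale mul form"
  shows "saa_dim10_class6 scale mul form"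
proof -
  interpret saa_P10_2_1 scale mul form by fact
  obtain x y where sb: "standard_basis 5 x y"
    and tri: "\<And>u v w. tri u v w = vol (coord x y u) (coord x y v) (coord x y w)"
    using presented unfolding has_presentation_iff by blast
  have L7: "lower_central (Suc 6) = {0}" using lower_central_7_zero[OF sb tri] by simp
  show ?thesis
  proof unfold_locales
    show "dim (UNIV :: 'v set) = 10" by (rule dim_UNIV_10[OF sb tri])
    show "isotropic center" by (rule isotropic_center[OF sb tri])
    show "dim center = 2" by (rule dim_center_2[OF sb tri])
    show "nilpotent" "nilpotency_class = 6"
      by (rule nilpotency_class_eqI[OF L7 lower_central_6_nonzero[OF sb tri]])+
    show "subspace_prod (lower_central 3) (lower_central 3) \<subseteq> center"
      by (rule L3L3_center[OF sb tri])
  qed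
qed

section \<open>A concrete model\<close>

text \<open>Arithmetic in the index type is modulo 10, so \<open>Y 5\<close> goes to 0 and the other
  labels of \<open>labels 5\<close> go to 1 up to 9.\<close>

definition idx :: "label \<Rightarrow> 10" where
  "idx l = (case l of X i \<Rightarrow> of_nat i | Y i \<Rightarrow> of_nat (i + 5))"

lemma inj_on_idx: "inj_on idx (labels 5)"
  unfolding labels_5 by (simp add: idx_def)

lemma range_idx: "idx ` labels 5 = UNIV"
  using inj_on_idx by (intro card_eq_UNIV_imp_eq_UNIV) (simp_all add: card_image card_labels)

definition coords10 :: "'f::field ^ 10 \<Rightarrow> label \<Rightarrow> 'f" where
  "coords10 u l = u $ idx l"

definition basis10 :: "label \<Rightarrow> 'f::field ^ 10" where
  "basis10 l = axis (idx l) 1"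

definition form10 :: "'f::field ^ 10 \<Rightarrow> 'f ^ 10 \<Rightarrow> 'f" where
  "form10 u v = (\<Sum>i\<in>{1..5}. coords10 u (X i) * coords10 v (Y i) - coords10 u (Y i) * coords10 v (X i))"

text \<open>The coefficients of a product are its form values on the dual basis vectors.\<close>

definition mul10 :: "'f::field ^ 10 \<Rightarrow> 'f ^ 10 \<Rightarrow> 'f ^ 10" where
  "mul10 u v = (\<Sum>i\<in>{1..5}. vol (coords10 u) (coords10 v) (unit_at (Y i)) *s basis10 (X i)
     - vol (coords10 u) (coords10 v) (unit_at (X i)) *s basis10 (Y i))"

lemma coords10_eqI: "(\<And>l. l \<in> labels 5 \<Longrightarrow> coords10 u l = coords10 v l) \<Longrightarrow> u = v"
  unfolding vec_eq_iff coords10_def using range_idx by (metis UNIV_I imageE)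

lemma coords10_linear:
  "coords10 (u + v) l = coords10 u l + coords10 v l" "coords10 (c *s u) l = c * coords10 u l"
  "coords10 (u - v) l = coords10 u l - coords10 v l"
  by (simp_all add: coords10_def)

lemma coords10_basis10:
  "a \<in> labels 5 \<Longrightarrow> l \<in> labels 5 \<Longrightarrow> coords10 (basis10 a) l = unit_at a l"
  using inj_on_eq_iff[OF inj_on_idx, of l a]
  by (auto simp: coords10_def basis10_def axis_def unit_at_def)

lemma coords10_mul10:
  "coords10 (mul10 u v) (X i) = vol (coords10 u) (coords10 v) (unit_at (Y i))"
  "coords10 (mul10 u v) (Y i) = - vol (coords10 u) (coords10 v) (unit_at (X i))"
  if "i \<in> {1..5}" for i
proof -
  have lab: "X j \<in> labels 5" "Y j \<in> labels 5" if "j \<in> {1..5}" for j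
    using that by (simp_all add: labels_def)
  have *: "coords10 (mul10 u v) l
      = (\<Sum>j\<in>{1..5}. vol (coords10 u) (coords10 v) (unit_at (Y j)) * coords10 (basis10 (X j)) l
         - vol (coords10 u) (coords10 v) (unit_at (X j)) * coords10 (basis10 (Y j)) l)" for l
    by (simp add: mul10_def coords10_def)
  have "coords10 (mul10 u v) (X i)
      = (\<Sum>j\<in>{1..5}. if j = i then vol (coords10 u) (coords10 v) (unit_at (Y i)) else 0)"
    unfolding * using that
    by (intro sum.cong refl) (simp add: coords10_basis10 lab unit_at_def del: atLeastAtMost_iff)
  then show "coords10 (mul10 u v) (X i) = vol (coords10 u) (coords10 v) (unit_at (Y i))"
    using that by simp
  have "coords10 (mul10 u v) (Y i)
      = (\<Sum>j\<in>{1..5}. if j = i then - vol (coords10 u) (coords10 v) (unit_at (X i)) else 0)"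
    unfolding * using that
    by (intro sum.cong refl) (simp add: coords10_basis10 lab unit_at_def del: atLeastAtMost_iff)
  then show "coords10 (mul10 u v) (Y i) = - vol (coords10 u) (coords10 v) (unit_at (X i))"
    using that by simp
qed

lemma vol_linear:
  "vol (\<lambda>l. f l + f' l) g h = vol f g h + vol f' g h" "vol (\<lambda>l. c * f l) g h = c * vol f g h"
  "vol f (\<lambda>l. g l + g' l) h = vol f g h + vol f g' h" "vol f (\<lambda>l. c * g l) h = c * vol f g h"
  by (simp_all add: vol_def minor_def algebra_simps)

text \<open>As \<open>mul10\<close> is defined by duality, pairing a product with \<open>w\<close>
  just expands \<open>vol\<close> linearly in its last argument.\<close>

lemma form10_mul10: "form10 (mul10 u v) w = vol (coords10 u) (coords10 v) (coords10 w)"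
proof -
  have "form10 (mul10 u v) w = (\<Sum>i\<in>{1..5}. vol (coords10 u) (coords10 v) (unit_at (Y i)) * coords10 w (Y i)
      + vol (coords10 u) (coords10 v) (unit_at (X i)) * coords10 w (X i))"
    unfolding form10_def by (intro sum.cong refl) (simp add: coords10_mul10 del: atLeastAtMost_iff)
  then show ?thesis
    unfolding numeral_interval_5
    by (simp add: vol_def minor_def unit_at_def algebra_simps del: One_nat_def)
qed

lemma coords10_lambda:
  "coords10 (u + v) = (\<lambda>l. coords10 u l + coords10 v l)" "coords10 (c *s u) = (\<lambda>l. c * coords10 u l)"
  by (simp_all add: coords10_linear fun_eq_iff)

lemma saa10: "symplectic_alternating_algebra (*s) mul10 (form10 :: 'f::field ^ 10 \<Rightarrow> _)"
proof -
  have lin: "Vector_Spaces.linear (*s) (*s) f"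
    if "\<And>u v. f (u + v) = f u + f v" "\<And>c u. f (c *s u) = c *s f u" for f :: "'f ^ 10 \<Rightarrow> 'f ^ 10"
    using that vec.vector_space_axioms by (simp add: Vector_Spaces.linear_iff)
  have lin': "Vector_Spaces.linear (*s) (*) f"
    if "\<And>u v. f (u + v) = f u + f v" "\<And>c u. f (c *s u) = c * f u" for f :: "'f ^ 10 \<Rightarrow> 'f"
    using that vec.vector_space_axioms
    by (simp add: Vector_Spaces.linear_iff vector_space_def algebra_simps)
  show ?thesis
  proof (intro symplectic_alternating_algebra.intro symplectic_alternating_algebra_axioms.intro)
    show "vector_space ((*s) :: 'f \<Rightarrow> 'f ^ 10 \<Rightarrow> _)" by (rule vec.vector_space_axioms)
    show "\<exists>B :: ('f ^ 10) set. finite B \<and> vec.span B = UNIV"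
      using vec.finite_Basis vec.span_Basis by blast
    fix u v w :: "'f ^ 10"
    show "Vector_Spaces.linear (*s) (*) (\<lambda>u. form10 u v)"
      by (rule lin') (simp_all add: form10_def coords10_linear algebra_simps sum.distrib
        sum_subtractf sum_distrib_left)
    show "Vector_Spaces.linear (*s) (*) (\<lambda>v. form10 u v)"
      by (rule lin') (simp_all add: form10_def coords10_linear algebra_simps sum.distrib
        sum_subtractf sum_distrib_left)
    show "form10 u u = 0" by (simp add: form10_def mult.commute)
    show "Vector_Spaces.linear (*s) (*s) (\<lambda>u. mul10 u v)"
      by (rule lin) (simp_all add: mul10_def coords10_lambda vol_linear vec.scale_left_distrib
        sum.distrib[symmetric] vec.scale_sum_right vec.scale_right_diff_distrib algebra_simps)
    show "Vector_Spaces.linear (*s) (*s) (\<lambda>v. mul10 u v)"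
      by (rule lin) (simp_all add: mul10_def coords10_lambda vol_linear vec.scale_left_distrib
        sum.distrib[symmetric] vec.scale_sum_right vec.scale_right_diff_distrib algebra_simps)
    show "mul10 u u = 0" by (simp add: mul10_def vol_eq_0)
    \<comment> \<open>The cyclic law becomes invariance of \<open>vol\<close> under a cyclic shift,
      which is a composition of two transpositions.\<close>
    show "form10 (mul10 u v) w = form10 (mul10 v w) u"
      unfolding form10_mul10
      using vol_swap12[of "coords10 v" "coords10 u"] vol_swap23[of "coords10 v" "coords10 w"]
      by simp
  next
    fix u :: "'f ^ 10"
    assume u: "\<And>v. form10 u v = 0"
    have lab: "X j \<in> labels 5" "Y j \<in> labels 5" if "j \<in> {1..5}" for j
      using that by (simp_all add: labels_def)
    show "u = 0"
    proof (rule coords10_eqI)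
      fix l assume "l \<in> labels 5"
      then obtain i where i: "i \<in> {1..5}" "l = X i \<or> l = Y i" by (auto simp: labels_def)
      \<comment> \<open>Nondegeneracy: pairing with the basis vectors recovers every coordinate of
        \<open>u\<close>.\<close>
      have "form10 u (basis10 (Y i)) = (\<Sum>j\<in>{1..5}. if j = i then coords10 u (X i) else 0)"
        unfolding form10_def using i(1)
        by (intro sum.cong refl) (simp add: coords10_basis10 lab unit_at_def del: atLeastAtMost_iff)
      moreover have "form10 u (basis10 (X i)) = (\<Sum>j\<in>{1..5}. if j = i then - coords10 u (Y i) else 0)"
        unfolding form10_def using i(1)
        by (intro sum.cong refl) (simp add: coords10_basis10 lab unit_at_def del: atLeastAtMost_iff)
      ultimately have "coords10 u (X i) = 0" "coords10 u (Y i) = 0"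
        using i(1) u by simp_all
      then show "coords10 u l = coords10 0 l" using i(2) by (auto simp: coords10_def)
    qed
  qed
qed

text \<open>With respect to the vectors \<open>basis10\<close>, \<open>coord\<close> agrees with
  \<open>coords10\<close> on \<open>labels 5\<close>, so \<open>form10_mul10\<close> is the formula
  of \<open>has_presentation_iff\<close>.\<close>

lemma saa_P10_2_1_coords: "saa_P10_2_1 (*s) mul10 (form10 :: 'f::field ^ 10 \<Rightarrow> _)"
proof -
  interpret A: symplectic_alternating_algebra "(*s)" mul10 "form10 :: 'f ^ 10 \<Rightarrow> _" by (rule saa10)
  let ?x = "\<lambda>i. basis10 (X i) :: 'f ^ 10" and ?y = "\<lambda>i. basis10 (Y i) :: 'f ^ 10"
  have lab: "X j \<in> labels 5" "Y j \<in> labels 5" if "j \<in> {1..5}" for j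
    using that by (simp_all add: labels_def)
  have x: "form10 u (?x i) = - coords10 u (Y i)" and y: "form10 u (?y i) = coords10 u (X i)"
    if "i \<in> {1..5}" for u i
  proof -
    have "form10 u (?y i) = (\<Sum>j\<in>{1..5}. if j = i then coords10 u (X i) else 0)"
      "form10 u (?x i) = (\<Sum>j\<in>{1..5}. if j = i then - coords10 u (Y i) else 0)"
      unfolding form10_def using that
      by (intro sum.cong refl; simp add: coords10_basis10 lab unit_at_def del: atLeastAtMost_iff)+
    then show "form10 u (?x i) = - coords10 u (Y i)" "form10 u (?y i) = coords10 u (X i)"
      using that by simp_all
  qed
  have "A.hyperbolic 5 ?x ?y"
    unfolding A.hyperbolic_def
    by (auto simp: x y coords10_basis10 lab unit_at_def simp del: atLeastAtMost_iff)
  moreover have "vec.dim (UNIV :: ('f ^ 10) set) = 2 * 5"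
    unfolding vec_dim_card by simp
  ultimately have sb: "A.standard_basis 5 ?x ?y"
    by (rule A.standard_basis_if_hyperbolic)
  have "A.coord ?x ?y u l = coords10 u l" if "l \<in> labels 5" for u l
    using that by (auto simp: labels_def A.coord_simps x y simp del: atLeastAtMost_iff)
  then have "A.tri u v w = vol (A.coord ?x ?y u) (A.coord ?x ?y v) (A.coord ?x ?y w)" for u v w
    unfolding A.tri_def form10_mul10 by (intro vol_cong) simp_all
  with sb have "A.has_presentation 5 ?x ?y P10_2_1"
    by (simp add: A.has_presentation_iff)
  then show ?thesis by unfold_locales blast
qed


section \<open>Generators of an algebra of class 6\<close>

context symplectic_alternating_algebra
begin

section \<open>Orthogonality relations\<close>

lemma subspace_perp: "subspace {v. form u v = 0}"
  by (simp add: subspace_def bilinear_simps)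

lemma subspace_prod_perp:
  assumes "\<And>u c. u \<in> U \<Longrightarrow> c \<in> V \<Longrightarrow> form w (u \<cdot> c) = 0" "z \<in> subspace_prod U V"
  shows "form w z = 0"
  using subspace_prod_subset[OF subspace_perp, of U V w] assms by blast

text \<open>Moving the last factor of \<open>v\<close> across the form lowers \<open>j\<close> and
  raises \<open>i\<close>, keeping \<open>i + j\<close>. At \<open>j = 0\<close> the vector
  \<open>u\<close> lies in the term that is zero.\<close>

lemma lower_central_perp:
  assumes "lower_central (Suc (i + j)) = {0}" "u \<in> lower_central (Suc i)" "v \<in> lower_central (Suc j)"
  shows "form u v = 0"
  using assms
proof (induction j arbitrary: i u v)
  case (Suc j)
  have "form u (w \<cdot> c) = 0" if "w \<in> lower_central (Suc j)" for w c
    using Suc.IH[of "Suc i" "u \<cdot> c" w] Suc.prems(1) mul_in_lower_central[OF _ Suc.prems(2)] that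
    by (simp add: form_mul_right del: lower_central.simps)
  with Suc.prems(3) show ?case
    unfolding lower_central_Suc[of "Suc j", OF zero_less_Suc]
    by (blast intro: subspace_prod_perp)
qed simp

text \<open>Self-adjointness turns (z, uc) into (zc, u). With the converse below, the center is
  exactly the orthogonal complement of L^2.\<close>

lemma center_perp_lower_central_2:
  assumes "z \<in> center" "l \<in> lower_central 2"
  shows "form z l = 0"
proof -
  have "l \<in> subspace_prod UNIV UNIV" using assms(2) by (simp add: numeral_2_eq_2)
  then show ?thesis
    using assms(1) by (elim subspace_prod_perp[rotated]) (simp add: form_mul_right center_def)
qed

lemma perp_lower_central_2_center:
  assumes "\<And>l. l \<in> lower_central 2 \<Longrightarrow> form z l = 0"
  shows "z \<in> center"
proof -
  have "form (z \<cdot> u) v = 0" for u v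
    using assms[of "v \<cdot> u"] by (simp add: numeral_2_eq_2 mul_in_subspace_prod form_mul_right)
  then show ?thesis by (auto simp: center_def intro: form_nondegenerate)
qed

lemma subspace_UNIV_if_perp_zero:
  assumes M: "subspace M" and perp: "\<And>u. (\<And>m. m \<in> M \<Longrightarrow> form u m = 0) \<Longrightarrow> u = 0"
  shows "M = UNIV"
proof -
  obtain B' where "finite_dimensional_vector_space scale B'" using ex_finite_dimensional by blast
  then interpret finite_dimensional_vector_space scale B' .
  interpret pair: finite_dimensional_vector_space_pair scale B' scale B' by unfold_locales
  obtain B where B: "B \<subseteq> M" "independent B" "M \<subseteq> span B" by (rule basis_exists)
  have fin: "finite B" using B(2) by (rule finiteI_independent)
  have span: "span B = M" using B M by (simp add: span_subspace)
  text \<open>An injective endomorphism of \<open>L\<close> is surjective, so \<open>T\<close>, with image in \<open>M\<close>, forces \<open>M = L\<close>.\<close>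
  define T where "T u = (\<Sum>b\<in>B. scale (form u b) b)" for u
  have lin: "Vector_Spaces.linear scale scale T"
    unfolding Vector_Spaces.linear_iff
    by (simp add: vector_space_axioms T_def bilinear_simps scale_left_distrib sum.distrib scale_sum_right)
  have "u = 0" if "T u = 0" for u
  proof (rule perp)
    fix m assume "m \<in> M"
    then have "m \<in> span B" using span by simp
    \<comment> \<open>By independence of \<open>B\<close> the coefficients in \<open>T u = 0\<close>
      vanish, so \<open>u\<close> is orthogonal to \<open>B\<close> and hence to
      \<open>M\<close>.\<close>
    moreover have "form u b = 0" if "b \<in> B" for b
      using independentD[OF B(2) fin order_refl \<open>T u = 0\<close>[unfolded T_def] that] .
    then have "span B \<subseteq> {v. form u v = 0}"
      by (intro span_minimal subspace_perp) auto
    ultimately show "form u m = 0" by blast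
  qed
  moreover have "T (u - v) = T u - T v" for u v
    by (simp add: T_def bilinear_simps scale_left_diff_distrib sum_subtractf)
  ultimately have "inj T"
    by (intro injI) (metis right_minus_eq)
  with lin have "surj T"
    by (rule pair.linear_injective_imp_surjective) (rule refl)
  moreover have "T u \<in> M" for u
    unfolding T_def span[symmetric] by (intro span_sum span_scale span_base)
  ultimately show ?thesis by (metis UNIV_eq_I surjD)
qed

text \<open>Otherwise the kernel of (z', -) lies in that of (z, -), so the two functionals are
  proportional and nondegeneracy puts \<open>z\<close> on the line of \<open>z'\<close>.\<close>

lemma ex_form_1_0:
  assumes "z \<notin> span {z'}"
  shows "\<exists>a. form z a = 1 \<and> form z' a = 0"
proof -
  have "\<exists>v. form z' v = 0 \<and> form z v \<noteq> 0"
  proof (rule ccontr)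
    assume "\<not> ?thesis"
    then have *: "form z v = 0" if "form z' v = 0" for v using that by blast
    have "\<exists>c. z = scale c z'"
    proof (cases "z' = 0")
      case True
      then have "z = 0" using * by (intro form_nondegenerate) simp
      then show ?thesis by (intro exI[of _ 0]) simp
    next
      case False
      then obtain v where v: "form z' v \<noteq> 0" using form_nondegenerate by blast
      \<comment> \<open>The vector \<open>w\<close>, reduced by a suitable multiple of
        \<open>v\<close>, lies in the kernel of (z', -).\<close>
      have "form z w = form (scale (form z v / form z' v) z') w" for w
        using *[of "w - scale (form z' w / form z' v) v"] v by (simp add: bilinear_simps)
      then show ?thesis using form_eqI by blast
    qed
    with assms show False by (auto simp: span_singleton)
  qed
  then obtain v where "form z' v = 0" "form z v \<noteq> 0" by blast
  then show ?thesis by (intro exI[of _ "scale (1 / form z v) v"]) (simp add: bilinear_simps)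
qed

text \<open>Containment in \<open>plus_line w S\<close> says "spanned by \<open>w\<close> modulo
  \<open>S\<close>"; nesting allows several generators, and membership yields explicit
  coefficients.\<close>

definition plus_line :: "'v \<Rightarrow> 'v set \<Rightarrow> 'v set" where
  "plus_line w S = {scale c w + s | c s. s \<in> S}"

lemma plus_lineI: "s \<in> S \<Longrightarrow> scale c w + s \<in> plus_line w S"
  by (auto simp: plus_line_def)

lemma plus_lineE:
  assumes "u \<in> plus_line w S"
  obtains c s where "s \<in> S" "u = scale c w + s"
  using assms by (auto simp: plus_line_def)

lemma subspace_plus_line:
  assumes "subspace S"
  shows "subspace (plus_line w S)"
  unfolding subspace_def
proof (intro conjI ballI allI)
  show "0 \<in> plus_line w S" using plus_lineI[OF subspace_0[OF assms], of 0 w] by simp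
next
  fix u v assume "u \<in> plus_line w S" "v \<in> plus_line w S"
  then obtain c s d t where "s \<in> S" "u = scale c w + s" "t \<in> S" "v = scale d w + t"
    by (elim plus_lineE)
  then show "u + v \<in> plus_line w S"
    using plus_lineI[OF subspace_add[OF assms, of s t], of "c + d" w]
    by (simp add: scale_left_distrib algebra_simps)
next
  fix c u assume "u \<in> plus_line w S"
  then obtain d s where "s \<in> S" "u = scale d w + s" by (elim plus_lineE)
  then show "scale c u \<in> plus_line w S"
    using plus_lineI[OF subspace_scale[OF assms, of s c], of "c * d" w]
    by (simp add: scale_right_distrib)
qed

text \<open>Dualizing a basis of the center gives a subspace with trivial orthogonal complement.\<close>

lemma ex_two_generators:
  assumes "dim center = 2"
  shows "\<exists>a b. plus_line a (plus_line b (lower_central 2)) = UNIV"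
proof -
  obtain B where B: "B \<subseteq> center" "independent B" "center \<subseteq> span B" "card B = 2"
    using basis_exists[of center] assms by metis
  then obtain z z' where z: "B = {z, z'}" "z \<noteq> z'" by (auto simp: card_2_iff)
  have "z \<notin> span {z'}" "z' \<notin> span {z}"
    using B(2) z independent_insert[of z "{z'}"] independent_insert[of z' "{z}"]
    by (auto simp: insert_commute)
  then obtain a b where ab: "form z a = 1" "form z' a = 0" "form z' b = 1" "form z b = 0"
    using ex_form_1_0 by meson
  define M where "M = plus_line a (plus_line b (lower_central 2))"
  have "M = UNIV"
  proof (rule subspace_UNIV_if_perp_zero)
    show "subspace M"
      unfolding M_def by (intro subspace_plus_line subspace_lower_central)
    fix u assume u: "\<And>m. m \<in> M \<Longrightarrow> form u m = 0"
    have mem: "scale c a + (scale d b + l) \<in> M" if "l \<in> lower_central 2" for c d l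
      unfolding M_def using that by (intro plus_lineI)
    have "form u l = 0" if "l \<in> lower_central 2" for l
      using u[OF mem[OF that, of 0 0]] by simp
    \<comment> \<open>Orthogonality to L^2 makes \<open>u\<close> central; pairing with
      \<open>a\<close> and \<open>b\<close> then kills both of its coefficients.\<close>
    then have "u \<in> span {z, z'}"
      using perp_lower_central_2_center[of u] B(3) z by blast
    then obtain c where "u - scale c z \<in> span {z'}"
      unfolding span_insert[of z "{z'}"] by blast
    then obtain d where "u - scale c z = scale d z'"
      unfolding span_singleton by blast
    then have "u = scale d z' + scale c z" by (simp add: diff_eq_eq)
    moreover have "form u a = 0" "form u b = 0"
      using u[OF mem[OF zero_in_lower_central, of 1 0]] u[OF mem[OF zero_in_lower_central, of 0 1]]
      by simp_all
    ultimately show "u = 0" using ab by (simp add: bilinear_simps)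
  qed
  then show ?thesis unfolding M_def by blast
qed

section \<open>Generators modulo the next terms of the series\<close>

lemma lower_central_mul:
  "u \<cdot> v \<in> lower_central 2"
  "u \<in> lower_central 2 \<Longrightarrow> u \<cdot> v \<in> lower_central 3"
  "u \<in> lower_central 3 \<Longrightarrow> u \<cdot> v \<in> lower_central 4"
  "u \<in> lower_central 4 \<Longrightarrow> u \<cdot> v \<in> lower_central 5"
  using mul_in_lower_central[of 1 u v] mul_in_lower_central[of 2 u v] mul_in_lower_central[of 3 u v]
    mul_in_lower_central[of 4 u v]
  by (simp_all del: lower_central.simps(3) add: numeral_2_eq_2[symmetric])

lemma lower_central_mul_right:
  "u \<in> lower_central 2 \<Longrightarrow> v \<cdot> u \<in> lower_central 3"
  "u \<in> lower_central 3 \<Longrightarrow> v \<cdot> u \<in> lower_central 4"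
  "u \<in> lower_central 4 \<Longrightarrow> v \<cdot> u \<in> lower_central 5"
  unfolding mul_skew[of v u] by (intro subspace_neg subspace_lower_central lower_central_mul; simp)+

lemma lower_central_closed:
  "u \<in> lower_central k \<Longrightarrow> v \<in> lower_central k \<Longrightarrow> u + v \<in> lower_central k"
  "u \<in> lower_central k \<Longrightarrow> scale c u \<in> lower_central k"
  "u \<in> lower_central k \<Longrightarrow> - u \<in> lower_central k"
  by (simp_all add: subspace_add subspace_scale subspace_neg subspace_lower_central)

text \<open>Expanding products of vectors written in generators, only a determinant times
  \<open>a \<cdot> b\<close> survives modulo L^3, and only multiples of
  \<open>a \<cdot> b \<cdot> a\<close> and \<open>a \<cdot> b \<cdot> b\<close> modulo L^4.\<close>

lemma lower_central_generators:
  assumes gen: "plus_line a (plus_line b (lower_central 2)) = UNIV"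
  shows "lower_central 2 \<subseteq> plus_line (a \<cdot> b) (lower_central 3)"
    "lower_central 3 \<subseteq> plus_line (a \<cdot> b \<cdot> a) (plus_line (a \<cdot> b \<cdot> b) (lower_central 4))"
proof -
  have ex: "\<exists>\<alpha> \<beta>. \<exists>l\<in>lower_central 2. u = scale \<alpha> a + (scale \<beta> b + l)" for u
  proof -
    have "u \<in> plus_line a (plus_line b (lower_central 2))" by (simp add: gen)
    then show ?thesis by (blast elim: plus_lineE)
  qed
  show L2: "lower_central 2 \<subseteq> plus_line (a \<cdot> b) (lower_central 3)"
    unfolding numeral_2_eq_2 lower_central.simps
  proof (rule subspace_prod_subset)
    show "subspace (plus_line (a \<cdot> b) (lower_central 3))"
      by (intro subspace_plus_line subspace_lower_central)
    fix u v :: 'v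
    obtain \<alpha> \<beta> l where u: "l \<in> lower_central 2" "u = scale \<alpha> a + (scale \<beta> b + l)"
      using ex by blast
    obtain \<alpha>' \<beta>' l' where v: "l' \<in> lower_central 2" "v = scale \<alpha>' a + (scale \<beta>' b + l')"
      using ex by blast
    have "u \<cdot> v = scale (\<alpha> * \<beta>' - \<beta> * \<alpha>') (a \<cdot> b)
        + (scale \<alpha> (a \<cdot> l') + scale \<beta> (b \<cdot> l') + l \<cdot> v)"
      unfolding u(2) v(2)
      by (simp add: bilinear_simps mul_alternating mul_skew[of b a] scale_left_diff_distrib
          scale_right_distrib algebra_simps)
    also have "\<dots> \<in> plus_line (a \<cdot> b) (lower_central 3)"
      using u(1) v(1)
      by (intro plus_lineI lower_central_closed lower_central_mul lower_central_mul_right)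
    finally show "u \<cdot> v \<in> plus_line (a \<cdot> b) (lower_central 3)" .
  qed
  have "lower_central 3 = subspace_prod (lower_central 2) UNIV"
    using lower_central_Suc[of 2] by simp
  then show "lower_central 3 \<subseteq> plus_line (a \<cdot> b \<cdot> a) (plus_line (a \<cdot> b \<cdot> b) (lower_central 4))"
  proof (simp only:, intro subspace_prod_subset)
    show "subspace (plus_line (a \<cdot> b \<cdot> a) (plus_line (a \<cdot> b \<cdot> b) (lower_central 4)))"
      by (intro subspace_plus_line subspace_lower_central)
    fix u v assume "u \<in> lower_central 2"
    then obtain c z where u: "z \<in> lower_central 3" "u = scale c (a \<cdot> b) + z"
      using L2 by (blast elim: plus_lineE)
    obtain \<alpha> \<beta> l where v: "l \<in> lower_central 2" "v = scale \<alpha> a + (scale \<beta> b + l)"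
      using ex by blast
    \<comment> \<open>Splitting \<open>l\<close> once more puts \<open>a \<cdot> b \<cdot> l\<close>
      into L^4: the multiple of \<open>a \<cdot> b\<close> in \<open>l\<close> is annihilated by
      alternation, and the rest lies in L^3.\<close>
    obtain d z' where l: "z' \<in> lower_central 3" "l = scale d (a \<cdot> b) + z'"
      using L2 v(1) by (blast elim: plus_lineE)
    have "u \<cdot> v = scale (c * \<alpha>) (a \<cdot> b \<cdot> a)
        + (scale (c * \<beta>) (a \<cdot> b \<cdot> b) + (scale c (a \<cdot> b \<cdot> z') + z \<cdot> v))"
      unfolding u(2) v(2) l(2)
      by (simp add: bilinear_simps mul_alternating scale_right_distrib algebra_simps)
    also have "\<dots> \<in> plus_line (a \<cdot> b \<cdot> a) (plus_line (a \<cdot> b \<cdot> b) (lower_central 4))"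
      using u(1) l(1)
      by (intro plus_lineI lower_central_closed lower_central_mul lower_central_mul_right)
    finally show "u \<cdot> v \<in> plus_line (a \<cdot> b \<cdot> a) (plus_line (a \<cdot> b \<cdot> b) (lower_central 4))" .
  qed
qed

section \<open>Consequences of the vanishing of L^7\<close>

context
  assumes L7: "lower_central 7 = {0}"
begin

lemma perp_4_4: "u \<in> lower_central 4 \<Longrightarrow> v \<in> lower_central 4 \<Longrightarrow> form u v = 0"
  and perp_5_3: "u \<in> lower_central 5 \<Longrightarrow> w \<in> lower_central 3 \<Longrightarrow> form u w = 0"
  using lower_central_perp[of 3 3 u v] lower_central_perp[of 4 2 u w] L7
  by (simp_all add: eval_nat_numeral del: lower_central.simps)

text \<open>For every \<open>w\<close>, (uv, w) = (wu, v) pairs two vectors of L^4.\<close>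

lemma mul_3_4: "u \<in> lower_central 3 \<Longrightarrow> v \<in> lower_central 4 \<Longrightarrow> u \<cdot> v = 0"
  and mul_4_3: "u \<in> lower_central 3 \<Longrightarrow> v \<in> lower_central 4 \<Longrightarrow> v \<cdot> u = 0"
proof -
  assume *: "u \<in> lower_central 3" "v \<in> lower_central 4"
  have "form (u \<cdot> v) w = 0" for w
    using perp_4_4[OF lower_central_mul_right(2)[OF *(1)] *(2), of w] tri_cyclic[of w u v]
    by (simp add: tri_def)
  then show "u \<cdot> v = 0" by (rule form_nondegenerate)
  then show "v \<cdot> u = 0" by (simp add: mul_skew[of v u])
qed

text \<open>If L^3 L^3 = 0, then (w, uc) is up to sign (wu, c) = 0 for \<open>w\<close>,
  \<open>u\<close> in L^3, so L^3 is orthogonal to L^4. Moving factors across the form, L^2 is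
  orthogonal to L^5 and L to L^6.\<close>

lemma lower_central_6_zero_if:
  assumes "\<And>u v. u \<in> lower_central 3 \<Longrightarrow> v \<in> lower_central 3 \<Longrightarrow> u \<cdot> v = 0"
  shows "lower_central 6 = {0}"
proof -
  have prod: "lower_central 4 = subspace_prod (lower_central 3) UNIV"
    "lower_central 5 = subspace_prod (lower_central 4) UNIV"
    "lower_central 6 = subspace_prod (lower_central 5) UNIV"
    using lower_central_Suc[of 3] lower_central_Suc[of 4] lower_central_Suc[of 5] by simp_all
  have mul: "form u (v \<cdot> c) = - form v (u \<cdot> c)" for u v c
    using form_skew[of v "u \<cdot> c"] by (simp add: form_mul_right)
  have 34: "form w z = 0" if "w \<in> lower_central 3" "z \<in> lower_central 4" for w z
    using that(2) unfolding prod
  proof (elim subspace_prod_perp[rotated])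
    fix u c assume "u \<in> lower_central 3"
    then have "w \<cdot> u = 0" using assms that by blast
    then show "form w (u \<cdot> c) = 0"
      using tri_cyclic[of w u c] tri_swap23[of w u c] tri_cyclic[of u c w] form_skew[of w "u \<cdot> c"]
      by (simp add: tri_def)
  qed
  have 25: "form w z = 0" if "w \<in> lower_central 2" "z \<in> lower_central 5" for w z
    using that(2) unfolding prod(2)
  proof (elim subspace_prod_perp[rotated])
    fix u c assume "u \<in> lower_central 4"
    then show "form w (u \<cdot> c) = 0"
      using 34[OF lower_central_mul(2)[OF that(1), of c]] by (simp add: form_mul_right)
  qed
  have "form w z = 0" if "z \<in> lower_central 6" for w z
    using that unfolding prod(3)
  proof (elim subspace_prod_perp[rotated])
    fix u c assume "u \<in> lower_central 5"
    then show "form w (u \<cdot> c) = 0"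
      using 25[OF lower_central_mul(1)[of w c]] by (simp add: form_mul_right)
  qed
  then have "z = 0" if "z \<in> lower_central 6" for z
    using that form_nondegenerate[of z] form_skew[of z] by fastforce
  then show ?thesis using zero_in_lower_central by auto
qed

text \<open>L^3 is spanned by the two factors modulo L^4, and L^3 L^4 = 0. If their product
  vanished, then so would L^3 L^3, and with it L^6.\<close>

lemma lower_central_3_generators_mul_nonzero:
  assumes gen: "plus_line a (plus_line b (lower_central 2)) = UNIV"
    and "lower_central 6 \<noteq> {0}"
  shows "a \<cdot> b \<cdot> a \<cdot> (a \<cdot> b \<cdot> b) \<noteq> 0"
proof
  let ?w = "a \<cdot> b \<cdot> a" and ?w' = "a \<cdot> b \<cdot> b"
  assume 0: "?w \<cdot> ?w' = 0"
  have w: "?w \<in> lower_central 3" "?w' \<in> lower_central 3"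
    by (intro lower_central_mul)+
  have "u \<cdot> v = 0" if uv: "u \<in> lower_central 3" "v \<in> lower_central 3" for u v
  proof -
    have ex: "\<exists>c d. \<exists>l\<in>lower_central 4. u = scale c ?w + (scale d ?w' + l)"
      if "u \<in> lower_central 3" for u
      using subsetD[OF lower_central_generators(2)[OF gen] that] by (blast elim: plus_lineE)
    obtain c d l where u: "l \<in> lower_central 4" "u = scale c ?w + (scale d ?w' + l)"
      using ex[OF uv(1)] by blast
    obtain c' d' l' where v: "l' \<in> lower_central 4" "v = scale c' ?w + (scale d' ?w' + l')"
      using ex[OF uv(2)] by blast
    have l: "l \<cdot> v = 0" using mul_4_3[OF uv(2) u(1)] .
    have l': "?w \<cdot> l' = 0" "?w' \<cdot> l' = 0" using mul_3_4 w v(1) by blast+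
    have swap: "?w' \<cdot> ?w = 0" using 0 by (simp add: mul_skew[of "?w'" ?w])
    have "u \<cdot> v = scale c (?w \<cdot> v) + (scale d (?w' \<cdot> v) + l \<cdot> v)"
      unfolding u(2) by (simp add: bilinear_simps)
    then show ?thesis
      unfolding l unfolding v(2) by (simp add: bilinear_simps mul_alternating l' 0 swap)
  qed
  then show False using lower_central_6_zero_if assms(2) by blast
qed

end

end


section \<open>Presenting an algebra of class 6\<close>

text \<open>A linear order on \<open>labels 5\<close> with every \<open>X\<close> before every
  \<open>Y\<close>.\<close>

definition rank :: "label \<Rightarrow> nat" where
  "rank l = (case l of X i \<Rightarrow> i | Y i \<Rightarrow> i + 5)"

text \<open>Reduces the 1000 label triples to increasing ones. Vanishing on repeated entries is
  assumed separately, since in characteristic 2 the sign changes do not imply it.\<close>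

lemma alternating_eq_0:
  fixes D :: "label \<Rightarrow> label \<Rightarrow> label \<Rightarrow> 'f::ab_group_add"
  assumes swap: "\<And>a b c. D b a c = - D a b c" "\<And>a b c. D a c b = - D a b c"
    and rep: "\<And>a b. D a a b = 0"
    and sorted: "\<And>a b c. a \<in> labels 5 \<Longrightarrow> b \<in> labels 5 \<Longrightarrow> c \<in> labels 5 \<Longrightarrow>
      rank a < rank b \<Longrightarrow> rank b < rank c \<Longrightarrow> D a b c = 0"
    and lab: "a \<in> labels 5" "b \<in> labels 5" "c \<in> labels 5"
  shows "D a b c = 0"
proof -
  have inj: "u = v" if "rank u = rank v" "u \<in> labels 5" "v \<in> labels 5" for u v
    using that by (auto simp: labels_def rank_def)
  have rep': "D u v u = 0" "D v u u = 0" for u v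
    using swap(2)[of u u v] swap(1)[of u v u] by (simp_all add: rep)
  have perm: "D a c b = 0 \<Longrightarrow> D a b c = 0" "D b a c = 0 \<Longrightarrow> D a b c = 0"
    "D b c a = 0 \<Longrightarrow> D a b c = 0" "D c a b = 0 \<Longrightarrow> D a b c = 0" "D c b a = 0 \<Longrightarrow> D a b c = 0"
    using swap(2)[of a b c] swap(1)[of a b c] swap(2)[of b a c] swap(1)[of a c b] swap(1)[of b c a] by simp_all
  consider "rank a = rank b" | "rank a = rank c" | "rank b = rank c"
    | "rank a < rank b" "rank b < rank c" | "rank a < rank c" "rank c < rank b"
    | "rank b < rank a" "rank a < rank c" | "rank b < rank c" "rank c < rank a"
    | "rank c < rank a" "rank a < rank b" | "rank c < rank b" "rank b < rank a"
    by linarith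
  then show ?thesis
  proof cases
    case 1
    then have "a = b" using lab inj by blast
    then show ?thesis by (simp add: rep)
  next
    case 2
    then have "a = c" using lab inj by blast
    then show ?thesis by (simp add: rep')
  next
    case 3
    then have "b = c" using lab inj by blast
    then show ?thesis by (simp add: rep')
  next
    case 4 then show ?thesis using sorted lab by blast
  next
    case 5 then have "D a c b = 0" using sorted lab by blast
    then show ?thesis by (rule perm)
  next
    case 6 then have "D b a c = 0" using sorted lab by blast
    then show ?thesis by (rule perm)
  next
    case 7 then have "D b c a = 0" using sorted lab by blast
    then show ?thesis by (rule perm)
  next
    case 8 then have "D c a b = 0" using sorted lab by blast
    then show ?thesis by (rule perm)
  next
    case 9 then have "D c b a = 0" using sorted lab by blast
    then show ?thesis by (rule perm)
  qed
qed

section \<open>Normalized generators and the standard basis they determine\<close>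

context symplectic_alternating_algebra
begin

text \<open>Two successive changes of generators: the first normalizes the pairings of the central
  element \<open>z\<close> with the generators, the second makes the two products in L^3 orthogonal
  and keeps \<open>z\<close> and its pairings.\<close>

lemma ex_generators_normalized:
  assumes L7: "lower_central 7 = {0}"
    and center: "a \<cdot> b \<cdot> a \<cdot> (a \<cdot> b \<cdot> b) \<in> center"
    and pq: "tri (a \<cdot> b \<cdot> a) (a \<cdot> b \<cdot> b) a \<noteq> 0 \<or> tri (a \<cdot> b \<cdot> a) (a \<cdot> b \<cdot> b) b \<noteq> 0"
  shows "\<exists>a b. a \<cdot> b \<cdot> a \<cdot> (a \<cdot> b \<cdot> b) \<in> center \<and> tri (a \<cdot> b \<cdot> a) (a \<cdot> b \<cdot> b) a = 0 \<and>
    tri (a \<cdot> b \<cdot> a) (a \<cdot> b \<cdot> b) b = 1 \<and> form (a \<cdot> b \<cdot> a) (a \<cdot> b \<cdot> b) = 0"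
proof -
  define z where "z = a \<cdot> b \<cdot> a \<cdot> (a \<cdot> b \<cdot> b)"
  define p where "p = form z a"
  define q where "q = form z b"
  have "p \<noteq> 0 \<or> q \<noteq> 0" using pq by (simp add: p_def q_def z_def tri_def)
  then have "\<exists>c d. p * c + q * d = 1"
  proof
    assume "p \<noteq> 0"
    then have "p * (1 / p) + q * 0 = 1" by simp
    then show ?thesis by blast
  next
    assume "q \<noteq> 0"
    then have "p * 0 + q * (1 / q) = 1" by simp
    then show ?thesis by blast
  qed
  then obtain c d where cd: "p * c + q * d = 1" by blast
  text \<open>The change of basis has determinant \<open>p * c + q * d = 1\<close>, so it preserves \<open>ab\<close> and \<open>z\<close>.\<close>
  define a1 where "a1 = scale q a - scale p b"
  define b1 where "b1 = scale c a + scale d b"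
  have "a1 \<cdot> b1 = scale (p * c + q * d) (a \<cdot> b)"
    by (simp add: a1_def b1_def bilinear_simps mul_alternating mul_skew[of b a] scale_left_distrib
        algebra_simps)
  then have ab1: "a1 \<cdot> b1 = a \<cdot> b" by (simp add: cd)
  have "a \<cdot> b \<cdot> a1 \<cdot> (a \<cdot> b \<cdot> b1) = scale (p * c + q * d) z"
    by (simp add: a1_def b1_def z_def bilinear_simps mul_alternating
        mul_skew[of "a \<cdot> b \<cdot> b" "a \<cdot> b \<cdot> a"] scale_left_distrib algebra_simps)
  then have z1: "a1 \<cdot> b1 \<cdot> a1 \<cdot> (a1 \<cdot> b1 \<cdot> b1) = z" unfolding ab1 by (simp add: cd)
  have form1: "form z a1 = 0" "form z b1 = 1"
    using cd by (simp_all add: a1_def b1_def bilinear_simps p_def[symmetric] q_def[symmetric] mult.commute)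
  define v where "v = a1 \<cdot> b1"
  define w where "w = v \<cdot> a1"
  define w' where "w' = v \<cdot> b1"
  define r where "r = form w w'"
  text \<open>Modulo \<open>L\<^sup>4\<close> this changes neither \<open>w\<close> nor \<open>w'\<close>, and it shifts \<open>form w w'\<close> by \<open>- r\<close>.\<close>
  define a2 where "a2 = a1 + scale r v"
  define l where "l = scale r (w' \<cdot> a1) + scale (r * r) (w' \<cdot> v)"
  define l' where "l' = scale r (w' \<cdot> b1)"
  have w: "w \<in> lower_central 3" "w' \<in> lower_central 3"
    unfolding w_def w'_def v_def by (intro lower_central_mul)+
  have l: "l \<in> lower_central 4" "l' \<in> lower_central 4"
    unfolding l_def l'_def using w by (simp_all add: lower_central_closed lower_central_mul)
  have ab2: "a2 \<cdot> b1 = v + scale r w'"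
    by (simp add: a2_def v_def w'_def bilinear_simps)
  have w2: "a2 \<cdot> b1 \<cdot> a2 = w + l"
    unfolding ab2 unfolding a2_def
    by (simp add: l_def w_def bilinear_simps mul_alternating algebra_simps)
  have w2': "a2 \<cdot> b1 \<cdot> b1 = w' + l'"
    unfolding ab2 by (simp add: l'_def w'_def bilinear_simps)
  have "l \<cdot> l' = 0"
    using subsetD[OF lower_central_antimono l(1), of 3] l(2) mul_3_4[OF L7] by simp
  then have z2: "(w + l) \<cdot> (w' + l') = z"
    using mul_3_4[OF L7 w(1) l(2)] mul_4_3[OF L7 w(2) l(1)] z1
    by (simp add: bilinear_simps w_def w'_def v_def)
  have zc: "z \<in> center" using center by (simp add: z_def)
  have "v \<in> lower_central 2" unfolding v_def by (rule lower_central_mul)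
  then have "form z v = 0" by (rule center_perp_lower_central_2[OF zc])
  then have form2: "form z a2 = 0" using form1 by (simp add: a2_def bilinear_simps)
  \<comment> \<open>As (w, w'b1) = -1, the correction \<open>l'\<close> contributes -r against (w,
    w') = r. The terms with \<open>l\<close> vanish, because (w'c, w') = 0 and L^4 is
    isotropic.\<close>
  have "tri w w' b1 = 1" using form1 z1 by (simp add: tri_def w_def w'_def v_def)
  then have "form w (w' \<cdot> b1) = -1"
    by (simp add: form_mul_right tri_def[symmetric] tri_swap23[of w b1 w'])
  moreover have "form l l' = 0" using perp_4_4[OF L7 l] .
  moreover have "form l w' = 0"
    using tri_eq_0(2)[of w'] by (simp add: l_def bilinear_simps tri_def)
  ultimately have form0: "form (w + l) (w' + l') = 0"
    by (simp add: bilinear_simps r_def[symmetric]) (simp add: l'_def bilinear_simps)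
  show ?thesis
    by (intro exI[of _ a2] exI[of _ b1]) (simp add: w2 w2' z2 zc tri_def form2 form1 form0)
qed

lemma ex_presentation:
  assumes dim: "dim (UNIV :: 'v set) = 10"
    and L7: "lower_central 7 = {0}"
    and center: "a \<cdot> b \<cdot> a \<cdot> (a \<cdot> b \<cdot> b) \<in> center"
    and p: "tri (a \<cdot> b \<cdot> a) (a \<cdot> b \<cdot> b) a = 0"
    and q: "tri (a \<cdot> b \<cdot> a) (a \<cdot> b \<cdot> b) b = 1"
    and r: "form (a \<cdot> b \<cdot> a) (a \<cdot> b \<cdot> b) = 0"
  shows "\<exists>x y. has_presentation 5 x y P10_2_1"
proof -
  define v where "v = a \<cdot> b"
  define w1 where "w1 = v \<cdot> a"
  define w2 where "w2 = v \<cdot> b"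
  \<comment> \<open>These choices are dictated by the target algebra, where
    \<open>y 2 \<cdot> y 5 = x 1\<close>, \<open>y 1 \<cdot> y 5 = - x 2\<close>,
    \<open>y 5 \<cdot> x 2 = x 3\<close>, \<open>x 1 \<cdot> y 3 = x 4\<close> and
    \<open>y 1 \<cdot> y 2 = x 5\<close>.\<close>
  define x1 where "x1 = w2 \<cdot> b"
  define x2 where "x2 = - (w1 \<cdot> b)"
  define x3 where "x3 = b \<cdot> x2"
  define x4 where "x4 = - (x1 \<cdot> v)"
  define x5 where "x5 = w1 \<cdot> w2"
  \<comment> \<open>Subtracting \<open>s\<close> times \<open>x5\<close> from \<open>a\<close> makes
    it orthogonal to \<open>b\<close>, since \<open>form x5 b = 1\<close>; as \<open>x5\<close> is
    central, no product changes.\<close>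
  define s where "s = form a b"
  define x where "x i = [x1, x2, x3, x4, x5] ! (i - 1)" for i
  define y where "y i = [w1, w2, - v, a - scale s x5, b] ! (i - 1)" for i
  have x: "x 1 = x1" "x 2 = x2" "x 3 = x3" "x 4 = x4" "x 5 = x5"
    and y: "y 1 = w1" "y 2 = w2" "y 3 = - v" "y 4 = a - scale s x5" "y 5 = b"
    by (simp_all add: x_def y_def)
  have v: "v \<in> lower_central 2" unfolding v_def by (rule lower_central_mul)
  then have w: "w1 \<in> lower_central 3" "w2 \<in> lower_central 3"
    unfolding w1_def w2_def by (simp_all add: lower_central_mul)
  then have X4: "x1 \<in> lower_central 4" "x2 \<in> lower_central 4" "x5 \<in> lower_central 4"
    unfolding x1_def x2_def x5_def by (simp_all add: lower_central_mul lower_central_closed)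
  then have X5: "x3 \<in> lower_central 5" "x4 \<in> lower_central 5"
    unfolding x3_def x4_def
    by (simp_all add: lower_central_mul lower_central_mul_right lower_central_closed)
  then have X4': "x3 \<in> lower_central 4" "x4 \<in> lower_central 4"
    using lower_central_antimono[of 4 5] by auto
  have x5c: "x5 \<in> center" using center by (simp add: x5_def w1_def w2_def v_def)
  note r' = r[folded v_def, folded w1_def w2_def]
  \<comment> \<open>Repeated entries give the values at \<open>w1\<close> and \<open>w2\<close>,
    centrality the one at \<open>v\<close>, and the normalization those at \<open>a\<close> and
    \<open>b\<close>.\<close>
  have x5: "form x5 w1 = 0" "form x5 w2 = 0" "form x5 v = 0" "form x5 a = 0" "form x5 b = 1"
    using tri_eq_0(2)[of w1 w2] tri_eq_0(3)[of w1 w2] center_perp_lower_central_2[OF x5c v] p q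
    by (simp_all add: x5_def tri_def w1_def w2_def v_def)
  have tri_b: "tri w2 b w1 = 1" "tri w1 b w2 = -1"
    using x5(5) tri_cyclic[of w1 w2 b] tri_swap23[of w1 b w2] by (simp_all add: tri_def x5_def)
  have ww: "form w1 w2 = 0" "form w2 w1 = 0" "form v w1 = 0" "form v w2 = 0" "form w1 v = 0"
    "form w2 v = 0" "form w1 a = 0" "form w2 b = 0" "form w1 b = 0" "form w2 a = 0"
    "form v a = 0" "form v b = 0"
  proof -
    show "form w1 w2 = 0" "form w2 w1 = 0" using r' form_skew[of w2 w1] by simp_all
    show *: "form w1 v = 0" "form w2 v = 0" "form w1 a = 0" "form w2 b = 0"
      using tri_eq_0(2)[of v a] tri_eq_0(2)[of v b] tri_eq_0(3)[of v a] tri_eq_0(3)[of v b]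
      by (simp_all add: tri_def w1_def w2_def)
    show "form v w1 = 0" "form v w2 = 0" using * form_skew[of v w1] form_skew[of v w2] by simp_all
    show "form v a = 0" "form v b = 0"
      using tri_eq_0(2)[of a b] tri_eq_0(3)[of a b] by (simp_all add: tri_def v_def)
    \<comment> \<open>Cyclically, (va, b) = (ab, v) = (v, v) = 0, and (vb, a) is its
      negative.\<close>
    show "form w1 b = 0" "form w2 a = 0"
      using tri_cyclic[of v a b] tri_swap23[of v a b] form_alternating[of v]
      by (simp_all add: tri_def w1_def w2_def v_def[symmetric] tri_cyclic[of v a b])
  qed
  have x1: "form x1 w1 = 1" "form x1 w2 = 0" "form x1 v = 0" "form x1 a = 0" "form x1 b = 0"
  proof -
    show "form x1 w1 = 1" using tri_b by (simp add: x1_def tri_def)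
    show "form x1 w2 = 0" "form x1 b = 0"
      using tri_eq_0(2)[of w2 b] tri_eq_0(3)[of w2 b] by (simp_all add: x1_def tri_def)
    have "form x1 v = form (b \<cdot> v) w2" unfolding x1_def by (rule form_mul_cyclic)
    then show "form x1 v = 0" by (simp add: mul_skew[of b v] w2_def[symmetric] bilinear_simps form_alternating)
    have "form x1 a = form (b \<cdot> a) w2" unfolding x1_def by (rule form_mul_cyclic)
    then show "form x1 a = 0" by (simp add: mul_skew[of b a] v_def[symmetric] bilinear_simps ww)
  qed
  have x2: "form x2 w1 = 0" "form x2 w2 = 1" "form x2 v = 0" "form x2 a = 0" "form x2 b = 0"
  proof -
    show "form x2 w2 = 1" using tri_b by (simp add: x2_def tri_def bilinear_simps)
    show "form x2 w1 = 0" "form x2 b = 0"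
      using tri_eq_0(2)[of w1 b] tri_eq_0(3)[of w1 b] by (simp_all add: x2_def tri_def bilinear_simps)
    have "form x2 v = - form (b \<cdot> v) w1"
      unfolding x2_def by (simp add: bilinear_simps form_mul_cyclic[of w1])
    then show "form x2 v = 0" by (simp add: mul_skew[of b v] w2_def[symmetric] bilinear_simps ww)
    have "form x2 a = - form (b \<cdot> a) w1"
      unfolding x2_def by (simp add: bilinear_simps form_mul_cyclic[of w1])
    then show "form x2 a = 0" by (simp add: mul_skew[of b a] v_def[symmetric] bilinear_simps ww)
  qed
  \<comment> \<open>Being in L^5, \<open>x3\<close> is orthogonal to L^3. Its other pairings are
    (ub, x2), already known; \<open>x4\<close> is treated likewise through
    \<open>x1\<close>.\<close>
  have x3: "form x3 w1 = 0" "form x3 w2 = 0" "form x3 v = -1" "form x3 a = 0" "form x3 b = 0"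
  proof -
    show "form x3 w1 = 0" "form x3 w2 = 0" using perp_5_3[OF L7 X5(1)] w by simp_all
    have "form x3 u = form (u \<cdot> b) x2" for u
      unfolding x3_def using tri_cyclic[of u b x2] by (simp add: tri_def)
    then show "form x3 v = -1" "form x3 a = 0" "form x3 b = 0"
      using x2 form_skew[of w2 x2] form_skew[of v x2]
      by (simp_all add: w2_def[symmetric] v_def[symmetric] mul_alternating)
  qed
  have x4: "form x4 w1 = 0" "form x4 w2 = 0" "form x4 v = 0" "form x4 a = 1" "form x4 b = 0"
  proof -
    show "form x4 w1 = 0" "form x4 w2 = 0" using perp_5_3[OF L7 X5(2)] w by simp_all
    have "form x4 u = - form (v \<cdot> u) x1" for u
      unfolding x4_def by (simp add: bilinear_simps form_mul_cyclic[of x1])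
    then show "form x4 v = 0" "form x4 a = 1" "form x4 b = 0"
      using x1 form_skew[of w1 x1] form_skew[of w2 x1]
      by (simp_all add: w1_def[symmetric] w2_def[symmetric] mul_alternating)
  qed
  have X: "x i \<in> lower_central 4" if "i \<in> {1..5}" for i
    using that X4 X4' unfolding numeral_interval_5 by (elim insertE emptyE) (simp_all only: x)
  have xw: "form (x i) w1 = (if i = 1 then 1 else 0)" "form (x i) w2 = (if i = 2 then 1 else 0)"
    "form (x i) v = (if i = 3 then -1 else 0)" "form (x i) a = (if i = 4 then 1 else 0)"
    "form (x i) b = (if i = 5 then 1 else 0)" if "i \<in> {1..5}" for i
    using that unfolding numeral_interval_5
    by (elim insertE emptyE; simp add: x x1 x2 x3 x4 x5 del: One_nat_def)+
  have xx: "form (x i) (x j) = 0" if "i \<in> {1..5}" "j \<in> {1..5}" for i j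
    using perp_4_4[OF L7] X that by blast
  have xx5: "form (x i) x5 = 0" if "i \<in> {1..5}" for i
    using xx[of i 5] that by (simp add: x)
  have xy: "form (x i) (y j) = (if i = j then 1 else 0)" if "i \<in> {1..5}" "j \<in> {1..5}" for i j
    using that(2) that(1) unfolding numeral_interval_5
    by (elim insertE emptyE; simp add: y bilinear_simps xw xx5 del: One_nat_def)+
  have yy: "form (y i) (y j) = 0" if "i \<in> {1..5}" "j \<in> {1..5}" for i j
  proof -
    have wx5: "form u x5 = - form x5 u" for u by (rule form_skew)
    have bv: "form b v = 0" "form a v = 0" "form b w1 = 0" "form a w1 = 0" "form b w2 = 0" "form a w2 = 0"
      using form_skew[of b v] form_skew[of a v] form_skew[of b w1] form_skew[of a w1]
        form_skew[of b w2] form_skew[of a w2] ww by simp_all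
    have ab: "form a b = s" "form b a = - s" by (simp_all add: s_def form_skew[of b a])
    show ?thesis
      using that unfolding numeral_interval_5
      by (elim insertE emptyE; simp add: y bilinear_simps ww bv ab wx5 x5 form_alternating del: One_nat_def)
  qed
  have hyp: "hyperbolic 5 x y" unfolding hyperbolic_def using xx yy xy by simp
  have sb: "standard_basis 5 x y"
    using hyp by (rule standard_basis_if_hyperbolic) (simp add: dim)
  have c0: "x5 \<cdot> u = 0" "u \<cdot> x5 = 0" for u
    using x5c mul_skew[of u x5] by (simp_all add: center_def)
  have xx0: "x i \<cdot> x j = 0" if "i \<in> {1..5}" "j \<in> {1..5}" for i j
    using mul_3_4[OF L7] subsetD[OF lower_central_antimono X[OF that(1)], of 3] X[OF that(2)] by simp
  have y12: "y 1 \<cdot> y 2 = x 5" by (simp only: x y x5_def)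
  have y34: "y 3 \<cdot> y 4 = - y 1"
    unfolding y by (simp add: bilinear_simps c0 w1_def)
  have y35: "y 3 \<cdot> y 5 = - y 2"
    unfolding y by (simp add: bilinear_simps w2_def)
  have y45: "y 4 \<cdot> y 5 = - y 3"
    unfolding y by (simp add: bilinear_simps c0 v_def)
  \<comment> \<open>A product with \<open>y 1\<close> or \<open>y 2\<close> lies in L^4, as does
    \<open>x i\<close>, and L^4 is isotropic.\<close>
  have yx: "form (y 1 \<cdot> u) (x i) = 0" "form (y 2 \<cdot> u) (x i) = 0" if "i \<in> {1..5}" for i u
    unfolding y using w X[OF that] by (simp_all add: perp_4_4[OF L7] lower_central_mul)
  have y21: "form (y 2 \<cdot> u) (y 1) = form (x 5) u" for u
    using form_mul_cyclic[of "y 1" "y 2" u] by (simp only: y12)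
  note forms = hyperbolic_forms[OF hyp]
  have lab: "i \<in> {1..5}" if "X i \<in> labels 5 \<or> Y i \<in> labels 5" for i
    using that by (auto simp: labels_def)
  define D where "D l m n = tri (basis_elem x y l) (basis_elem x y m) (basis_elem x y n)
    - vol (unit_at l) (unit_at m) (unit_at n)" for l m n
  have "D l m n = 0" if "l \<in> labels 5" "m \<in> labels 5" "n \<in> labels 5" for l m n
  proof (rule alternating_eq_0[of D, OF _ _ _ _ that])
    fix l m n :: label
    show "D m l n = - D l m n"
      unfolding D_def tri_swap12[of "basis_elem x y m"] vol_swap12[of "unit_at m"] by simp
    show "D l n m = - D l m n"
      unfolding D_def tri_swap23[of _ "basis_elem x y n"] vol_swap23[of _ "unit_at n"] by simp
    show "D l l m = 0" by (simp add: D_def tri_eq_0 vol_eq_0)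
    assume l: "l \<in> labels 5" and m: "m \<in> labels 5" and n: "n \<in> labels 5"
      and lm: "rank l < rank m" and mn: "rank m < rank n"
    show "D l m n = 0"
    \<comment> \<open>In an increasing triple either the first two labels are \<open>X\<close>, with
      product zero, or the last two are \<open>Y\<close>. In the latter case the value is the
      pairing of \<open>y j \<cdot> y k\<close> with the first vector.\<close>
    proof (cases m)
      case (X j)
      then obtain i where i: "l = X i" using lm lab[of j] m by (cases l) (auto simp: rank_def)
      have "tri (x i) (x j) u = 0" for u
        using xx0[of i j] lab l m i X by (simp add: tri_def)
      then show ?thesis by (simp add: D_def i X vol_def minor_def unit_at_def)
    next
      case (Y j)
      then obtain k where k: "n = Y k" "j < k"
        using mn lab[of j] lab m n by (cases n) (fastforce simp: rank_def)+
      have jk: "j \<in> {1..5}" "k \<in> {1..5}" using lab Y k m n by blast+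
      have pairs: "(j, k) \<in> {(1, 2), (1, 3), (1, 4), (1, 5), (2, 3), (2, 4), (2, 5), (3, 4), (3, 5), (4, 5)}"
        using jk k(2) unfolding numeral_interval_5 by (elim insertE emptyE; simp)
      have D: "D l m n = form (y j \<cdot> y k) (basis_elem x y l) - vol (unit_at l) (unit_at m) (unit_at n)"
        unfolding D_def tri_def Y k(1) by (simp add: form_mul_cyclic[of _ "y j"])
      show ?thesis
      proof (cases l)
        case (X i)
        have i: "i \<in> {1..5}" using lab l X by blast
        from i show ?thesis
          using pairs unfolding D unfolding X Y k(1) numeral_interval_5
          by (elim insertE emptyE; simp only: prod.inject; elim conjE; hypsubst;
              simp add: yx y34 y35 y45 bilinear_simps forms vol_def minor_def unit_at_def del: One_nat_def)
      next
        case Y': (Y i)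
        have i: "i \<in> {1..5}" "i < j" using lab l Y' lm Y by (auto simp: rank_def)
        have "(i, j, k) \<in> {(1, 2, 3), (1, 2, 4), (1, 2, 5), (1, 3, 4), (1, 3, 5), (1, 4, 5), (2, 3, 4),
            (2, 3, 5), (2, 4, 5), (3, 4, 5)}"
          using i pairs unfolding numeral_interval_5 by (elim insertE emptyE; simp)
        then show ?thesis
          unfolding D unfolding Y' Y k(1)
          by (elim insertE emptyE; simp only: prod.inject; elim conjE; hypsubst;
              simp add: y21 y34 y35 y45 bilinear_simps forms vol_def minor_def unit_at_def del: One_nat_def)
      qed
    qed
  qed
  then have "tri (basis_elem x y l) (basis_elem x y m) (basis_elem x y n)
      = vol (unit_at l) (unit_at m) (unit_at n)"
    if "l \<in> labels 5" "m \<in> labels 5" "n \<in> labels 5" for l m n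
    using that by (simp add: D_def)
  from tri_eq_vol_if_basis[OF sb this] sb have "has_presentation 5 x y P10_2_1"
    by (simp add: has_presentation_iff)
  then show ?thesis by blast
qed

end

section \<open>From the structural conditions to the presentation, and the conclusion\<close>

lemma saa_presented_if_dim10_class6:
  fixes scale :: "'f::field \<Rightarrow> 'v::ab_group_add \<Rightarrow> 'v"
  assumes "saa_dim10_class6 scale mul form"
  shows "saa_P10_2_1 scale mul form"
proof -
  interpret saa_dim10_class6 scale mul form by fact
  have L7: "lower_central 7 = {0}" and L6: "lower_central 6 \<noteq> {0}"
    using nilpotency_class_eqD[OF nilpotent, of 5] class_6 by simp_all
  obtain a b where gen: "plus_line a (plus_line b (lower_central 2)) = UNIV"
    using ex_two_generators[OF dim_center] by blast
  define w where "w = mul (mul a b) a"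
  define w' where "w' = mul (mul a b) b"
  have "w \<in> lower_central 3" "w' \<in> lower_central 3"
    unfolding w_def w'_def by (intro lower_central_mul)+
  then have c: "mul w w' \<in> center"
    using L3L3_le_center mul_in_subspace_prod by blast
  have "mul w w' \<noteq> 0"
    unfolding w_def w'_def by (rule lower_central_3_generators_mul_nonzero[OF L7 gen L6])
  then obtain u where u: "form (mul w w') u \<noteq> 0" using form_nondegenerate by blast
  obtain \<alpha> \<beta> l where l: "l \<in> lower_central 2" "u = scale \<alpha> a + (scale \<beta> b + l)"
  proof -
    have "u \<in> plus_line a (plus_line b (lower_central 2))" by (simp add: gen)
    then show ?thesis using that by (blast elim: plus_lineE)
  qed
  \<comment> \<open>The central element pairs to zero with L^2, so its nonzero pairing with
    \<open>u\<close> must come from \<open>a\<close> or \<open>b\<close>.\<close>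
  have "form (mul w w') l = 0" by (rule center_perp_lower_central_2[OF c l(1)])
  then have "tri w w' a \<noteq> 0 \<or> tri w w' b \<noteq> 0"
    using u unfolding l(2) by (auto simp: bilinear_simps tri_def)
  from ex_generators_normalized[OF L7 c[unfolded w_def w'_def] this[unfolded w_def w'_def]]
  obtain a b where ab: "mul (mul (mul a b) a) (mul (mul a b) b) \<in> center"
    "tri (mul (mul a b) a) (mul (mul a b) b) a = 0" "tri (mul (mul a b) a) (mul (mul a b) b) b = 1"
    "form (mul (mul a b) a) (mul (mul a b) b) = 0"
    by blast
  have "\<exists>x y. has_presentation 5 x y P10_2_1" by (rule ex_presentation[OF dim_10 L7 ab])
  then show ?thesis by unfold_locales
qed

text \<open>Existence is stated on \<open>'f^10\<close> because an arbitrary \<open>'v\<close> may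
  carry no such algebra. Uniqueness passes from both algebras to their presentations and matches
  coordinates.\<close>

theorem proposition3p1:
  fixes scale :: "'f::field \<Rightarrow> 'v::ab_group_add \<Rightarrow> 'v"
    and mul :: "'v \<Rightarrow> 'v \<Rightarrow> 'v" and form :: "'v \<Rightarrow> 'v \<Rightarrow> 'f"
    and scale' :: "'f \<Rightarrow> 'w::ab_group_add \<Rightarrow> 'w"
    and mul' :: "'w \<Rightarrow> 'w \<Rightarrow> 'w" and form' :: "'w \<Rightarrow> 'w \<Rightarrow> 'f"
  shows "(\<exists>(mul0 :: 'f^10 \<Rightarrow> 'f^10 \<Rightarrow> 'f^10) (form0 :: 'f^10 \<Rightarrow> 'f^10 \<Rightarrow> 'f).
            saa_dim10_class6 (*s) mul0 form0) \<and>
         (saa_dim10_class6 scale mul form \<and> saa_dim10_class6 scale' mul' form' \<longrightarrow>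
            saa_isomorphic scale mul form scale' mul' form') \<and>
         (saa_dim10_class6 scale mul form \<longleftrightarrow> saa_P10_2_1 scale mul form)"
proof (intro conjI impI iffI)
  show "\<exists>(mul0 :: 'f^10 \<Rightarrow> 'f^10 \<Rightarrow> 'f^10) (form0 :: 'f^10 \<Rightarrow> 'f^10 \<Rightarrow> 'f).
      saa_dim10_class6 (*s) mul0 form0"
    by (intro exI) (rule saa_dim10_class6_if_presented[OF saa_P10_2_1_coords])
  show "saa_isomorphic scale mul form scale' mul' form'"
    if "saa_dim10_class6 scale mul form \<and> saa_dim10_class6 scale' mul' form'"
    using that by (intro saa_isomorphic_if_presented saa_presented_if_dim10_class6; elim conjE)
  show "saa_P10_2_1 scale mul form" if "saa_dim10_class6 scale mul form"
    using that by (rule saa_presented_if_dim10_class6)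
  show "saa_dim10_class6 scale mul form" if "saa_P10_2_1 scale mul form"
    using that by (rule saa_dim10_class6_if_presented)
qed

end
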